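(* For $n=0,1,2,\dots$ let $$\Lambda_n(t,q_0,q_1,\dots,q_{2n})=\int_{\mathbf{C}^{2n+1}}\frac{t\left(\sum_{k=0}^{2n}(-1)^kx_k\right)\prod_{k=0}^{2n}q_k(x_k)}{(x_0-x_1)(\bar x_1-\bar x_2)\cdots(\bar x_{2n-1}-\bar x_{2n})}\,dx_0\,dx_1\cdots dx_{2n}.$$ If $1/p+1/p'=1$ and $|1/p-1/2|<1/10$, then there is a constant $c$, independent of $n$, such that for all $n$ and all $t\in L^p(\mathbf{C})$, $q_0\in L^{p'}(\mathbf{C})$, $q_1,\dots,q_{2n}\in L^2(\mathbf{C})$, $$|\Lambda_n(t,q_0,q_1,\dots,q_{2n})|\le c^n\,\|t\|_{1/p}\,\|q_0\|_{1/p'}\prod_{j=1}^{2n}\|q_j\|_{1/2}.$$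
   Context: Each $x_j$ is a complex variable and $dx_j$ is Lebesgue measure on the complex plane. In the denominator the factors are alternately $x_{k-1}-x_k$ for $k$ odd and $\bar x_{k-1}-\bar x_k$ for $k$ even, $k=1,\dots,2n$ (for $n=0$ the denominator is $1$). $\|f\|_{1/p}$ denotes the $L^p(\mathbf{C})$ norm of $f$. *)

theory Defs
  imports "HOL-Analysis.Analysis"
begin

definition Lp_space :: "real \<Rightarrow> (complex \<Rightarrow> complex) set" where
  "Lp_space p = {f \<in> borel_measurable lebesgue. integrable lebesgue (\<lambda>x. norm (f x) powr p)}"

definition Lp_norm :: "real \<Rightarrow> (complex \<Rightarrow> complex) \<Rightarrow> real" where
  "Lp_norm p f = (integral\<^sup>L lebesgue (\<lambda>x. norm (f x) powr p)) powr (1 / p)"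

text \<open>
  Lebesgue measure on the space of tuples $(x_0, \dots, x_{2n})$ of complex numbers. The completion
  is taken after forming the product: for Lebesgue measurable \<open>t\<close>, the function
  \<open>x \<mapsto> t (x\<^sub>0 - x\<^sub>1 + \<dots> + x\<^sub>2\<^sub>n)\<close> need not be measurable with respect to the product of the
  one-variable Lebesgue \<open>\<sigma>\<close>-algebras.
\<close>

definition lebesgue_tuples :: "nat \<Rightarrow> (nat \<Rightarrow> complex) measure" where
  "lebesgue_tuples n = completion (Pi\<^sub>M {0..2*n} (\<lambda>_. lborel))"

definition Lambda_denom :: "nat \<Rightarrow> (nat \<Rightarrow> complex) \<Rightarrow> complex" where
  "Lambda_denom n x =
     (\<Prod>k\<in>{1..2*n}. if odd k then x (k - 1) - x k else cnj (x (k - 1)) - cnj (x k))"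

text \<open>
  The argument \<open>q\<close> below is the family $q_0, \dots, q_{2n}$; its values at indices greater than $2n$
  are not used. Where the denominator vanishes (a null set) the integrand is $0$.
\<close>

definition Lambda_integrand ::
  "nat \<Rightarrow> (complex \<Rightarrow> complex) \<Rightarrow> (nat \<Rightarrow> complex \<Rightarrow> complex) \<Rightarrow> (nat \<Rightarrow> complex) \<Rightarrow> complex" where
  "Lambda_integrand n t q x =
     t (\<Sum>k\<in>{0..2*n}. (-1) ^ k * x k) * (\<Prod>k\<in>{0..2*n}. q k (x k)) / Lambda_denom n x"

definition Lambda_form ::
  "nat \<Rightarrow> (complex \<Rightarrow> complex) \<Rightarrow> (nat \<Rightarrow> complex \<Rightarrow> complex) \<Rightarrow> complex" where
  "Lambda_form n t q = integral\<^sup>L (lebesgue_tuples n) (Lambda_integrand n t q)"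

end

theory Submission
  imports Defs
begin

text \<open>
  Everything is bounded with absolute values inside, so all functions below take values in
  \<open>[0, \<infinity>]\<close>, and \<open>B = 1 / (2 p)\<close>, which lies strictly between \<open>0\<close> and \<open>1/2\<close>.

  The form is integrated one variable at a time, starting with the last one. The partial alternating
  sum \<open>s = x\<^sub>0 - x\<^sub>1 + \<dots> \<plusminus> x\<^sub>m\<close> and the last variable \<open>x = x\<^sub>m\<close> are all that the rest of the integrand
  sees of the first \<open>m + 1\<close> variables. Integrating out \<open>y = x\<^sub>m\<^sub>+\<^sub>1\<close> therefore turns a function
  \<open>G\<close> of two variables into another function of two variables, the integral over \<open>y\<close> of
  \<open>G (s \<plusminus> y) y q(y) / \<bar>x - y\<bar>\<close>; this is the operator \<open>peel\<close>. The start is \<open>G s x = t s\<close>.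

  The space in which all intermediate functions live is \<open>L\<^sup>R(C \<times> C)\<close> with the single exponent
  \<open>R = 2 p\<close>. It is invariant under the shear \<open>(s, y) \<mapsto> (s \<plusminus> y, y)\<close>. For fixed \<open>s\<close>, multiplying by
  \<open>q \<in> L\<^sup>2\<close> loses \<open>1/2\<close> in the reciprocal exponent by Hoelder, and convolving with \<open>1/\<bar>x\<bar>\<close> gains
  \<open>1/2\<close> by Hardy-Littlewood-Sobolev, so \<open>peel\<close> is bounded on \<open>L\<^sup>R(C \<times> C)\<close> with norm at most a
  constant times \<open>\<parallel>q\<parallel>\<^sub>2\<close> (\<open>peel_bound\<close>). This is where the geometric growth \<open>c\<^sup>n\<close> comes from. Two
  steps are special. Unless it vanishes, \<open>(s, x) \<mapsto> t s\<close> is in no space \<open>L\<^sup>R(C \<times> C)\<close>, but one application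
  of \<open>peel\<close> puts it there (\<open>peel_bound_initial\<close>): a Young-type estimate for \<open>t (s \<plusminus> y) q(y)\<close>
  replaces Hoelder. At the other end the remaining weight \<open>q\<^sub>0(x) q\<^sub>1(y) / \<bar>x - y\<bar>\<close> belongs to the
  dual space of \<open>L\<^sup>R(C \<times> C)\<close> by the Hardy-Littlewood-Sobolev inequality with the kernel
  \<open>\<bar>x - y\<bar>\<close> to the power \<open>-R'\<close> (\<open>peel_bound_final\<close>).

  The Hardy-Littlewood-Sobolev inequality itself follows from a pointwise inequality
  (\<open>HLS_pointwise\<close>) which dominates its integrand by a sum of three functions, each of which can be
  integrated trivially.
\<close>

section \<open>Powers of extended nonnegative reals and Hoelder's inequality\<close>

definition epow :: "ennreal \<Rightarrow> real \<Rightarrow> ennreal" where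
  "epow x r = (if x = top then top else ennreal (enn2real x powr r))"

lemma epow_ennreal [simp]: "0 \<le> a \<Longrightarrow> epow (ennreal a) r = ennreal (a powr r)"
  by (simp add: epow_def)

lemma epow_top [simp]: "epow top r = top"
  by (simp add: epow_def)

lemma epow_0 [simp]: "epow 0 r = 0"
  by (simp add: epow_def)

lemma epow_1 [simp]: "epow x 1 = x"
  by (cases x) auto

lemma epow_eq_0_iff [simp]: "epow x r = 0 \<longleftrightarrow> x = 0"
  by (cases x) (auto simp: ennreal_eq_0_iff)

lemma epow_eq_top_iff [simp]: "epow x r = top \<longleftrightarrow> x = top"
  by (cases x) auto

lemma epow_mult: "epow (x * y) r = epow x r * epow y r"
proof (cases "x = 0 \<or> y = 0")
  case False
  then show ?thesis
    by (cases x; cases y)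
       (auto simp: ennreal_mult[symmetric] powr_mult ennreal_mult_top ennreal_top_mult)
qed auto

lemma epow_epow: "epow (epow x r) s = epow x (r * s)"
  by (cases x) (auto simp: powr_powr)

lemma epow_add: "epow x (r + s) = epow x r * epow x s"
  by (cases x) (auto simp: powr_add ennreal_mult)

lemma epow_mono: "x \<le> y \<Longrightarrow> 0 \<le> r \<Longrightarrow> epow x r \<le> epow y r"
  by (cases x; cases y) (auto simp: powr_mono2 top_unique)

lemma borel_measurable_epow [measurable (raw)]:
  assumes [measurable]: "f \<in> borel_measurable M"
  shows "(\<lambda>x. epow (f x) r) \<in> borel_measurable M"
  unfolding epow_def by measurable

text \<open>
  Hoelder's inequality in its geometric-mean form: writing the two factors as powers of densities
  keeps the exponents of all later applications linear in \<open>th\<close>. After normalising the two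
  integrals it is the weighted inequality between arithmetic and geometric means, integrated.
\<close>

lemma nn_integral_Holder:
  assumes [measurable]: "f \<in> borel_measurable M" "g \<in> borel_measurable M"
    and th: "0 < th" "th < 1"
  shows "(\<integral>\<^sup>+x. epow (f x) th * epow (g x) (1 - th) \<partial>M)
           \<le> epow (\<integral>\<^sup>+x. f x \<partial>M) th * epow (\<integral>\<^sup>+x. g x \<partial>M) (1 - th)"
    (is "?L \<le> epow ?a th * epow ?b (1 - th)")
proof -
  consider "?a = 0" | "?b = 0" | "?a \<noteq> 0" "?b \<noteq> 0" "?a = top \<or> ?b = top"
    | a b where "?a = ennreal a" "?b = ennreal b" "a > 0" "b > 0"
    by (cases ?a; cases ?b) (auto simp: ennreal_eq_0_iff, force)
  then show ?thesis
  proof cases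
    case 1
    then have "AE x in M. f x = 0" by (simp add: nn_integral_0_iff_AE)
    then have "?L = (\<integral>\<^sup>+x. 0 \<partial>M)" by (intro nn_integral_cong_AE) auto
    then show ?thesis by simp
  next
    case 2
    then have "AE x in M. g x = 0" by (simp add: nn_integral_0_iff_AE)
    then have "?L = (\<integral>\<^sup>+x. 0 \<partial>M)" by (intro nn_integral_cong_AE) auto
    then show ?thesis by simp
  next
    case 3
    then have "epow ?a th * epow ?b (1 - th) = top"
      by (auto simp: ennreal_mult_eq_top_iff)
    then show ?thesis by simp
  next
    case 4
    have pt: "epow (f x) th * epow (g x) (1 - th)
        \<le> ennreal (a powr th * b powr (1 - th) * (th / a)) * f x
          + ennreal (a powr th * b powr (1 - th) * ((1 - th) / b)) * g x" (is "_ \<le> ?R") for x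
    proof -
      consider "f x = top \<or> g x = top" | u v where "f x = ennreal u" "g x = ennreal v" "u \<ge> 0"
          "v \<ge> 0"
        by (cases "f x"; cases "g x") auto
      then show ?thesis
      proof cases
        case 1
        have "?R = top" using 1 4 th by (auto simp: ennreal_mult_top)
        then show ?thesis by (simp only: top_greatest)
      next
        case 2
        have "(u/a) powr th * (v/b) powr (1 - th) \<le> th * (u/a) + (1 - th) * (v/b)"
          using Youngs_inequality_0[of th "1 - th" "u/a" "v/b"] th 2 4
          by (cases "u = 0 \<or> v = 0") auto
        then have "a powr th * b powr (1 - th) * ((u/a) powr th * (v/b) powr (1 - th))
            \<le> a powr th * b powr (1 - th) * (th * (u/a) + (1 - th) * (v/b))"
          by (intro mult_left_mono) auto
        then have "u powr th * v powr (1 - th)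
            \<le> a powr th * b powr (1 - th) * (th / a) * u
              + a powr th * b powr (1 - th) * ((1 - th) / b) * v"
          using 2 4 by (simp add: powr_divide field_simps)
        then show ?thesis using 2 4 th
          by (simp add: ennreal_mult'[symmetric] ennreal_plus[symmetric] ennreal_leI del: ennreal_plus)
      qed
    qed
    have "?L \<le> (\<integral>\<^sup>+x. ?R x \<partial>M)"
      by (intro nn_integral_mono pt)
    also have "\<dots> = ennreal (a powr th * b powr (1 - th) * (th / a)) * ?a
          + ennreal (a powr th * b powr (1 - th) * ((1 - th) / b)) * ?b"
      by (simp add: nn_integral_add nn_integral_cmult)
    also have "\<dots> = epow ?a th * epow ?b (1 - th)"
      using 4 th by (simp add: ennreal_mult'[symmetric] ennreal_plus[symmetric] field_simps del: ennreal_plus)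
    finally show ?thesis .
  qed
qed

section \<open>The Hardy-Littlewood-Sobolev inequality in the plane\<close>

lemma le_suminf_ennreal: "(g::nat \<Rightarrow> ennreal) k \<le> suminf g"
  using sum_le_suminf[of g "{k}"] by simp

text \<open>
  Radial integrals are estimated from a geometric sequence of balls. With \<open>s = 1/2\<close> the balls shrink
  to the centre, which handles a singularity with \<open>l < 2\<close>; with \<open>s = 2\<close> they exhaust the plane, which
  handles a tail with \<open>l > 2\<close>. In both cases the areas times the heights form a geometric series with
  ratio \<open>s\<close> to the power \<open>2 - l\<close>.
\<close>

lemma nn_integral_geometric_cover:
  fixes h :: "complex \<Rightarrow> ennreal"
  assumes L: "0 < L" and s: "0 < s" "s powr (2 - l) < 1"
    and cover: "\<And>y. h y \<noteq> 0 \<Longrightarrow> \<exists>k::nat. dist x y < L * s ^ k \<and> h y \<le>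
        ennreal ((L * s ^ k / 2) powr - l)"
  shows "(\<integral>\<^sup>+y. h y \<partial>lborel) \<le> ennreal (pi * 2 powr l / (1 - s powr (2 - l)) * L powr (2 - l))"
proof -
  let ?R = "\<lambda>k. L * s ^ k"
  have "(\<integral>\<^sup>+y. h y \<partial>lborel)
      \<le> (\<integral>\<^sup>+y. (\<Sum>k. ennreal ((?R k / 2) powr - l) * indicator (ball x (?R k)) y) \<partial>lborel)"
  proof (rule nn_integral_mono)
    fix y
    show "h y \<le> (\<Sum>k. ennreal ((?R k / 2) powr - l) * indicator (ball x (?R k)) y)" (is "_
        \<le> suminf ?g")
    proof (cases "h y = 0")
      case False
      then obtain k where k: "dist x y < ?R k" "h y \<le> ennreal ((?R k / 2) powr - l)"
        using cover by blast
      then have "h y \<le> ?g k" by simp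
      also have "\<dots> \<le> suminf ?g"
        by (rule le_suminf_ennreal[of ?g k])
      finally show ?thesis .
    qed simp
  qed
  also have "\<dots> = (\<Sum>k. ennreal ((?R k / 2) powr - l) * emeasure lborel (ball x (?R k)))"
  proof (rule trans[OF nn_integral_suminf])
    show "(\<Sum>k. \<integral>\<^sup>+y. ennreal ((?R k / 2) powr - l) * indicator (ball x (?R k)) y \<partial>lborel)
        = (\<Sum>k. ennreal ((?R k / 2) powr - l) * emeasure lborel (ball x (?R k)))"
      by (intro suminf_cong nn_integral_cmult_indicator)
          (simp only: sets_lborel borel_open open_ball)
  qed (rule borel_measurable_times_ennreal borel_measurable_indicator borel_measurable_const | simp only: sets_lborel borel_open open_ball)+
  also have "\<dots> = (\<Sum>k. ennreal (pi * 2 powr l * L powr (2 - l) * (s powr (2 - l)) ^ k))"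
  proof (rule suminf_cong)
    fix k
    have R: "?R k > 0" using L s by simp
    have "(s ^ k) powr (2 - l) = (s powr real k) powr (2 - l)"
      using s by (simp only: powr_realpow)
    also have "\<dots> = (s powr (2 - l)) powr real k"
      by (simp only: powr_powr mult.commute[of "real k"])
    also have "\<dots> = (s powr (2 - l)) ^ k"
      using s by (simp add: powr_realpow)
    finally have "?R k powr (2 - l) = L powr (2 - l) * (s powr (2 - l)) ^ k"
      using L s by (simp add: powr_mult)
    moreover have "?R k powr (2 - l) = (?R k)\<^sup>2 * ?R k powr - l"
      using R powr_add[of "?R k" 2 "-l"] by (simp add: powr_numeral)
    moreover have "(?R k / 2) powr - l = ?R k powr - l * 2 powr l"
      using R by (simp add: powr_divide powr_minus field_simps)
    ultimately have "(?R k / 2) powr - l * (pi * (?R k)\<^sup>2)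
        = pi * 2 powr l * L powr (2 - l) * (s powr (2 - l)) ^ k"
      by (simp only: mult_ac)
    then show "ennreal ((?R k / 2) powr - l) * emeasure lborel (ball x (?R k))
        = ennreal (pi * 2 powr l * L powr (2 - l) * (s powr (2 - l)) ^ k)"
      using R by (simp add: emeasure_ball unit_ball_vol_2 ennreal_mult'[symmetric])
  qed
  also have "\<dots> = ennreal (pi * 2 powr l * L powr (2 - l) * (1 / (1 - s powr (2 - l))))"
    using s by (intro suminf_ennreal_eq sums_mult geometric_sums) auto
  finally show ?thesis by (simp add: mult_ac)
qed

lemma radial_integral_inner:
  fixes l :: real
  assumes l: "0 < l" "l < 2"
  obtains C where "0 \<le> C" "\<And>L (x::complex). 0 < L \<Longrightarrow>
     (\<integral>\<^sup>+y. ennreal (if dist x y < L then dist x y powr - l else 0) \<partial>lborel) \<le>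
         ennreal (C * L powr (2 - l))"
proof
  let ?C = "pi * 2 powr l / (1 - (1/2) powr (2 - l))"
  have half: "(1/2) powr (2 - l) < (1::real)"
    using l powr_less_mono2[of "2 - l" "1/2" 1] by simp
  show "0 \<le> ?C" using half by simp
  fix L :: real and x :: complex assume L: "0 < L"
  show "(\<integral>\<^sup>+y. ennreal (if dist x y < L then dist x y powr - l else 0) \<partial>lborel) \<le>
      ennreal (?C * L powr (2 - l))"
  proof (rule nn_integral_geometric_cover[OF L _ half])
    fix y assume "ennreal (if dist x y < L then dist x y powr - l else 0) \<noteq> 0"
    then have d: "dist x y < L" "0 < dist x y" by (auto split: if_splits)
    \<comment> \<open>the annulus that contains \<open>y\<close>; the ball \<open>k\<close> has radius \<open>L / 2\<^sup>k\<close>\<close>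
    define k where "k = (LEAST k. L * (1/2) ^ Suc k \<le> dist x y)"
    obtain k0 where "(1/2) ^ k0 < dist x y / L"
      using real_arch_pow_inv[of "dist x y / L" "1/2"] d L by auto
    then have "L * (1/2) ^ k0 \<le> dist x y" using L by (simp add: field_simps)
    moreover have "L * (1/2) ^ Suc k0 \<le> L * (1/2) ^ k0" using L by simp
    ultimately have "L * (1/2) ^ Suc k0 \<le> dist x y" by linarith
    then have k: "L * (1/2) ^ Suc k \<le> dist x y" unfolding k_def by (rule LeastI)
    have "dist x y < L * (1/2) ^ k"
    proof (cases k)
      case (Suc j)
      then have "j < k" by simp
      then have "\<not> L * (1/2) ^ Suc j \<le> dist x y"
        unfolding k_def by (rule not_less_Least)
      then show ?thesis using Suc by simp
    qed (use d in simp)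
    moreover have "dist x y powr - l \<le> (L * (1/2) ^ k / 2) powr - l"
      using k L l by (intro powr_mono2') auto
    ultimately show "\<exists>k. dist x y < L * (1/2) ^ k \<and>
        ennreal (if dist x y < L then dist x y powr - l else 0) \<le>
            ennreal ((L * (1/2) ^ k / 2) powr - l)"
      using d by (intro exI[of _ k]) (auto intro: ennreal_leI)
  qed simp
qed

lemma radial_integral_outer:
  fixes l :: real
  assumes l: "2 < l"
  obtains C where "0 \<le> C" "\<And>L (x::complex). 0 < L \<Longrightarrow>
     (\<integral>\<^sup>+y. ennreal (if dist x y < L then 0 else dist x y powr - l) \<partial>lborel) \<le>
         ennreal (C * L powr (2 - l))"
proof
  let ?D = "pi * 2 powr l / (1 - 2 powr (2 - l))"
  let ?C = "?D * 2 powr (2 - l)"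
  have two: "2 powr (2 - l) < (1::real)" using l powr_less_mono[of "2 - l" 0 2] by simp
  show "0 \<le> ?C" using two by simp
  fix L :: real and x :: complex assume L: "0 < L"
  have "(\<integral>\<^sup>+y. ennreal (if dist x y < L then 0 else dist x y powr - l) \<partial>lborel)
      \<le> ennreal (?D * (2 * L) powr (2 - l))"
  proof (rule nn_integral_geometric_cover[OF _ _ two])
    fix y assume "ennreal (if dist x y < L then 0 else dist x y powr - l) \<noteq> 0"
    then have d: "L \<le> dist x y" by (auto split: if_splits)
    \<comment> \<open>the ball \<open>k\<close> has radius \<open>2\<^sup>k\<close> times \<open>2 L\<close>, so its half radius is at most the distance\<close>
    define k where "k = (LEAST k. dist x y < 2 * L * 2 ^ k)"
    obtain k0 where "dist x y / L < 2 ^ k0"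
      using real_arch_pow[of 2 "dist x y / L"] by auto
    then have "dist x y < L * 2 ^ k0" using L by (simp add: field_simps)
    moreover have "L * 2 ^ k0 \<le> 2 * L * 2 ^ k0" using L by simp
    ultimately have "dist x y < 2 * L * 2 ^ k0" by linarith
    then have k: "dist x y < 2 * L * 2 ^ k" unfolding k_def by (rule LeastI)
    have "L * 2 ^ k \<le> dist x y"
    proof (cases k)
      case (Suc j)
      then have "j < k" by simp
      then have "\<not> dist x y < 2 * L * 2 ^ j"
        unfolding k_def by (rule not_less_Least)
      then show ?thesis using Suc by simp
    qed (use d in simp)
    then have "dist x y powr - l \<le> (2 * L * 2 ^ k / 2) powr - l"
      using L l by (intro powr_mono2') auto
    then show "\<exists>k. dist x y < 2 * L * 2 ^ k \<and>
        ennreal (if dist x y < L then 0 else dist x y powr - l) \<le>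
            ennreal ((2 * L * 2 ^ k / 2) powr - l)"
      using d k by (intro exI[of _ k]) (auto intro: ennreal_leI)
  qed (use L in auto)
  also have "?D * (2 * L) powr (2 - l) = ?C * L powr (2 - l)"
    using L by (simp add: powr_mult)
  finally show "(\<integral>\<^sup>+y. ennreal (if dist x y < L then 0 else dist x y powr - l) \<partial>lborel)
      \<le> ennreal (?C * L powr (2 - l))" .
qed

text \<open>
  The weight is the best bound, uniform in \<open>v \<le> u\<close>, for the Hardy-Littlewood-Sobolev integrand
  divided by \<open>u\<close>, in the region where that integrand exceeds \<open>u v\<close>: near the singularity \<open>v\<close> is
  replaced by \<open>u\<close>, and away from it \<open>v\<close> is bounded through the condition that defines the region.
  The threshold radius is the natural length scale of a density of height \<open>u\<close>.
\<close>

definition HLS_weight :: "real \<Rightarrow> real \<Rightarrow> real \<Rightarrow> real \<Rightarrow> real" where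
  "HLS_weight A B u r =
     (if r < u powr - (1/2) then u powr (1 - (A + B)) * r powr - (2 * (A + B))
      else u powr - (A / B) * r powr - (2 * (A + B) / B))"

lemma HLS_weight_nonneg [simp]: "0 \<le> HLS_weight A B u r"
  by (simp add: HLS_weight_def)

text \<open>
  In the far region all quantities are positive and both the hypothesis \<open>big\<close> and the claim are linear
  in the logarithms; the claim is the hypothesis multiplied by \<open>(1 - B) / B\<close>.
\<close>

lemma HLS_pointwise_half:
  assumes A: "0 < A" and B: "0 < B" "B < 1" and v: "0 < v" "v \<le> u" and r: "0 < r"
    and big: "u * v < u powr (1 - A) * v powr (1 - B) * r powr - (2 * (A + B))"
  shows "u powr (1 - A) * v powr (1 - B) * r powr - (2 * (A + B)) \<le> u * HLS_weight A B u r"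
proof (cases "r < u powr - (1/2)")
  case True
  have "v powr (1 - B) \<le> u powr (1 - B)" using v B by (intro powr_mono2) auto
  then have "u powr (1 - A) * v powr (1 - B) * r powr - (2 * (A + B))
      \<le> u powr (1 - A) * u powr (1 - B) * r powr - (2 * (A + B))"
    by (intro mult_right_mono mult_left_mono) auto
  also have "u powr (1 - A) * u powr (1 - B) = u * u powr (1 - (A + B))"
    using v by (simp add: powr_mult_base algebra_simps flip: powr_add)
  finally show ?thesis using True v by (simp add: HLS_weight_def mult_ac)
next
  case False
  define a b c where "a = ln u" "b = ln v" "c = ln r"
  have eqs: "u = exp a" "v = exp b" "r = exp c" using v r by (auto simp: a_b_c_def)
  have "B * b < - A * a - 2 * (A + B) * c"
    using big unfolding eqs by (simp add: powr_def flip: exp_add) (simp add: algebra_simps)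
  then have "(1 - B) / B * (B * b) \<le> (1 - B) / B * (- A * a - 2 * (A + B) * c)"
    using B by (intro mult_left_mono) auto
  then have "(1 - A) * a + (1 - B) * b - 2 * (A + B) * c \<le> a - A / B * a - 2 * (A + B) / B * c"
    using B by (simp add: field_simps)
  then show ?thesis using False unfolding eqs
    by (simp add: HLS_weight_def powr_def flip: exp_add) (simp add: algebra_simps)
qed

text \<open>
  For probability densities with values \<open>u\<close> and \<open>v\<close> at two points at distance \<open>r\<close>, the first term on the
  right integrates to at most \<open>1\<close>. The other two are handled by integrating first over the point whose
  density does not occur in the term: by \<open>HLS_weight_integral\<close> below, the weight has an integral
  bounded by a constant, which leaves the integral of the other density.
\<close>

lemma HLS_pointwise:
  assumes A: "0 < A" and B: "0 < B" and AB: "A + B < 1" and u: "0 \<le> u" and v: "0 \<le> v" and r: "0 \<le> r"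
  shows "u powr (1 - A) * v powr (1 - B) * r powr - (2 * (A + B))
           \<le> u * v + u * HLS_weight A B u r + v * HLS_weight B A v r" (is "?L \<le> _")
proof -
  have nn: "0 \<le> u * v" "0 \<le> u * HLS_weight A B u r" "0 \<le> v * HLS_weight B A v r"
    using u v by auto
  consider "u = 0 \<or> v = 0 \<or> r = 0" | "?L \<le> u * v" | "u > 0" "v > 0" "r > 0" "u * v < ?L"
    using u v r by linarith
  then show ?thesis
  proof cases
    case 3
    show ?thesis
    proof (cases "v \<le> u")
      case True
      then have "?L \<le> u * HLS_weight A B u r"
        using 3 assms by (intro HLS_pointwise_half) auto
      then show ?thesis using nn by linarith
    next
      case False
      have L: "?L = v powr (1 - B) * u powr (1 - A) * r powr - (2 * (B + A))"
          by (simp add: mult_ac add_ac)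
      have big: "v * u < v powr (1 - B) * u powr (1 - A) * r powr - (2 * (B + A))"
        using 3(4) unfolding L by (subst mult.commute)
      have "?L \<le> v * HLS_weight B A v r"
        unfolding L using 3(1-3) assms(1-3) False big by (intro HLS_pointwise_half) auto
      then show ?thesis using nn by linarith
    qed
  qed (use nn in auto)
qed

lemma borel_measurable_HLS_weight [measurable]:
  "case_prod (HLS_weight A B) \<in> borel_measurable (borel \<Otimes>\<^sub>M borel)"
  unfolding HLS_weight_def[abs_def] by measurable

text \<open>
  Scaling makes the bound independent of \<open>u\<close>. The inner part converges because \<open>2 (A + B) < 2\<close>, the
  outer part because \<open>2 (A + B) / B > 2\<close>; the latter is where \<open>0 < A\<close> enters.
\<close>

lemma HLS_weight_integral:
  assumes A: "0 < A" and B: "0 < B" and AB: "A + B < 1"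
  obtains C where "0 \<le> C" "\<And>u (x::complex). 0 < u \<Longrightarrow>
     (\<integral>\<^sup>+y. ennreal (HLS_weight A B u (dist x y)) \<partial>lborel) \<le> ennreal C"
proof -
  let ?l = "2 * (A + B)"
  obtain C1 where C1: "0 \<le> C1" "\<And>L (x::complex). 0 < L \<Longrightarrow>
     (\<integral>\<^sup>+y. ennreal (if dist x y < L then dist x y powr - ?l else 0) \<partial>lborel) \<le>
         ennreal (C1 * L powr (2 - ?l))"
    using radial_integral_inner[of ?l] A B AB by auto
  have "2 < ?l / B" using A B by (simp add: field_simps)
  then obtain C2 where C2: "0 \<le> C2" "\<And>L (x::complex). 0 < L \<Longrightarrow>
     (\<integral>\<^sup>+y. ennreal (if dist x y < L then 0 else dist x y powr - (?l / B)) \<partial>lborel)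
       \<le> ennreal (C2 * L powr (2 - ?l / B))"
    using radial_integral_outer[of "?l / B"] by auto
  show thesis
  proof
    show "0 \<le> C1 + C2" using C1 C2 by simp
    fix u :: real and x :: complex assume u: "0 < u"
    let ?L = "u powr - (1/2)"
    have "(\<integral>\<^sup>+y. ennreal (HLS_weight A B u (dist x y)) \<partial>lborel)
       = (\<integral>\<^sup>+y. ennreal (u powr (1 - (A + B))) *
           ennreal (if dist x y < ?L then dist x y powr - ?l else 0)
             + ennreal (u powr - (A / B)) *
                 ennreal (if dist x y < ?L then 0 else dist x y powr - (?l / B)) \<partial>lborel)"
      by (intro nn_integral_cong) (auto simp: HLS_weight_def ennreal_mult)
    also have "\<dots> = ennreal (u powr (1 - (A + B)))
        * (\<integral>\<^sup>+y. ennreal (if dist x y < ?L then dist x y powr - ?l else 0) \<partial>lborel)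
        + ennreal (u powr - (A / B))
            * (\<integral>\<^sup>+y. ennreal (if dist x y < ?L then 0 else dist x y powr - (?l / B)) \<partial>lborel)"
      by (subst nn_integral_add) (simp_all add: nn_integral_cmult)
    also have "\<dots> \<le> ennreal (u powr (1 - (A + B))) * ennreal (C1 * ?L powr (2 - ?l))
        + ennreal (u powr - (A / B)) * ennreal (C2 * ?L powr (2 - ?l / B))"
      using u by (intro add_mono mult_left_mono C1 C2) auto
    also have "\<dots> = ennreal (C1 * (u powr (1 - (A + B)) * ?L powr (2 - ?l)) + C2
        * (u powr - (A / B) * ?L powr (2 - ?l / B)))"
      using C1 C2 by (simp add: ennreal_mult'[symmetric] ennreal_plus[symmetric] mult_ac del: ennreal_plus)
    also have "u powr (1 - (A + B)) * ?L powr (2 - ?l) = 1"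
      using u by (simp add: powr_powr algebra_simps flip: powr_add)
    also have "u powr - (A / B) * ?L powr (2 - ?l / B) = 1"
      using u B by (simp add: powr_powr field_simps flip: powr_add)
    finally show "(\<integral>\<^sup>+y. ennreal (HLS_weight A B u (dist x y)) \<partial>lborel) \<le> ennreal (C1 + C2)" by simp
  qed
qed

lemma Hardy_Littlewood_Sobolev_normalised:
  assumes A: "0 < A" and B: "0 < B" and AB: "A + B < 1"
  obtains C where "0 \<le> C" "\<And>F H :: complex \<Rightarrow> ennreal.
     F \<in> borel_measurable borel \<Longrightarrow> H \<in> borel_measurable borel \<Longrightarrow>
     (\<integral>\<^sup>+x. F x \<partial>lborel) \<le> 1 \<Longrightarrow> (\<integral>\<^sup>+x. H x \<partial>lborel) \<le> 1 \<Longrightarrow>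
     (\<integral>\<^sup>+x. \<integral>\<^sup>+y. epow (F x) (1 - A) * epow (H y) (1 - B) *
         ennreal (dist x y powr - (2 * (A + B))) \<partial>lborel \<partial>lborel)
       \<le> ennreal C"
proof -
  obtain C1 where C1: "0 \<le> C1" "\<And>u (x::complex). 0 < u \<Longrightarrow>
     (\<integral>\<^sup>+y. ennreal (HLS_weight A B u (dist x y)) \<partial>lborel) \<le> ennreal C1"
    using HLS_weight_integral[OF A B AB] by blast
  have BA: "B + A < 1" using AB by simp
  obtain C2 where C2: "0 \<le> C2" "\<And>u (x::complex). 0 < u \<Longrightarrow>
     (\<integral>\<^sup>+y. ennreal (HLS_weight B A u (dist x y)) \<partial>lborel) \<le> ennreal C2"
    using HLS_weight_integral[OF B A BA] by blast
  show thesis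
  proof
    show "0 \<le> 1 + C1 + C2" using C1 C2 by simp
    fix F H :: "complex \<Rightarrow> ennreal"
    assume [measurable]: "F \<in> borel_measurable borel" "H \<in> borel_measurable borel"
      and F1: "(\<integral>\<^sup>+x. F x \<partial>lborel) \<le> 1" and H1: "(\<integral>\<^sup>+x. H x \<partial>lborel) \<le> 1"
    define P where "P x y = F x * ennreal (HLS_weight A B (enn2real (F x)) (dist x y))" for x y
    define Q where "Q x y = H y * ennreal (HLS_weight B A (enn2real (H y)) (dist y x))" for x y
    have [measurable]: "case_prod P \<in> borel_measurable (borel \<Otimes>\<^sub>M borel)"
      "case_prod Q \<in> borel_measurable (borel \<Otimes>\<^sub>M borel)"
      unfolding P_def[abs_def] Q_def[abs_def] by measurable
    have "(\<integral>\<^sup>+x. F x \<partial>lborel) \<noteq> top" "(\<integral>\<^sup>+x. H x \<partial>lborel) \<noteq> top"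
      using F1 H1 by (auto simp: top_unique)
    then have fin: "AE x in lborel. F x \<noteq> top" "AE x in lborel. H x \<noteq> top"
      using nn_integral_PInf_AE[of F lborel] nn_integral_PInf_AE[of H lborel] by simp_all
    have "(\<integral>\<^sup>+x. \<integral>\<^sup>+y. epow (F x) (1 - A) * epow (H y) (1 - B) *
        ennreal (dist x y powr - (2 * (A + B))) \<partial>lborel \<partial>lborel)
       \<le> (\<integral>\<^sup>+x. \<integral>\<^sup>+y. (F x * H y + P x y + Q x y) \<partial>lborel \<partial>lborel)"
      using fin(1)
    proof (intro nn_integral_mono_AE, eventually_elim)
      fix x assume x: "F x \<noteq> top"
      show "(\<integral>\<^sup>+y. epow (F x) (1 - A) * epow (H y) (1 - B) *
          ennreal (dist x y powr - (2 * (A + B))) \<partial>lborel)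
         \<le> (\<integral>\<^sup>+y. (F x * H y + P x y + Q x y) \<partial>lborel)"
        using fin(2)
      proof (intro nn_integral_mono_AE, eventually_elim)
        fix y assume y: "H y \<noteq> top"
        obtain u v where uv: "F x = ennreal u" "0 \<le> u" "H y = ennreal v" "0 \<le> v"
          using x y by (cases "F x"; cases "H y") auto
        then show "epow (F x) (1 - A) * epow (H y) (1 - B) * ennreal (dist x y powr - (2 * (A + B)))
            \<le> F x * H y + P x y + Q x y"
          using HLS_pointwise[OF A B AB uv(2,4), of "dist x y"]
          by (simp add: P_def Q_def ennreal_mult'[symmetric] ennreal_plus[symmetric] dist_commute ennreal_leI del: ennreal_plus)
      qed
    qed
    also have "\<dots> = (\<integral>\<^sup>+x. \<integral>\<^sup>+y. F x * H y \<partial>lborel \<partial>lborel) + (\<integral>\<^sup>+x. \<integral>\<^sup>+y. P x y \<partial>lborel \<partial>lborel)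
        + (\<integral>\<^sup>+x. \<integral>\<^sup>+y. Q x y \<partial>lborel \<partial>lborel)"
      by (simp add: nn_integral_add)
    also have "(\<integral>\<^sup>+x. \<integral>\<^sup>+y. F x * H y \<partial>lborel \<partial>lborel) = (\<integral>\<^sup>+x. F x \<partial>lborel) * (\<integral>\<^sup>+y. H y \<partial>lborel)"
      by (simp add: nn_integral_cmult nn_integral_multc)
    also have "\<dots> \<le> 1 * 1" using F1 H1 by (rule mult_mono) auto
    also have "(\<integral>\<^sup>+x. \<integral>\<^sup>+y. P x y \<partial>lborel \<partial>lborel) \<le> (\<integral>\<^sup>+x. ennreal C1 * F x \<partial>lborel)"
      using fin(1)
    proof (intro nn_integral_mono_AE, eventually_elim)
      fix x assume x: "F x \<noteq> top"
      have "(\<integral>\<^sup>+y. P x y \<partial>lborel) = F x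
          * (\<integral>\<^sup>+y. ennreal (HLS_weight A B (enn2real (F x)) (dist x y)) \<partial>lborel)"
        unfolding P_def by (intro nn_integral_cmult) measurable
      also have "\<dots> \<le> F x * ennreal C1"
      proof (cases "F x = 0")
        case False
        then show ?thesis using x
            by (intro mult_left_mono C1)
            (auto simp: enn2real_positive_iff less_top zero_less_iff_neq_zero)
      qed simp
      finally show "(\<integral>\<^sup>+y. P x y \<partial>lborel) \<le> ennreal C1 * F x" by (simp add: mult.commute)
    qed
    also have "\<dots> \<le> ennreal C1 * 1" using F1
        by (simp add: nn_integral_cmult mult_left_mono del: mult.right_neutral)
    also have "(\<integral>\<^sup>+x. \<integral>\<^sup>+y. Q x y \<partial>lborel \<partial>lborel) = (\<integral>\<^sup>+y. \<integral>\<^sup>+x. Q x y \<partial>lborel \<partial>lborel)"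
      by (rule lborel_pair.Fubini') measurable
    also have "\<dots> \<le> (\<integral>\<^sup>+y. ennreal C2 * H y \<partial>lborel)"
      using fin(2)
    proof (intro nn_integral_mono_AE, eventually_elim)
      fix y assume y: "H y \<noteq> top"
      have "(\<integral>\<^sup>+x. Q x y \<partial>lborel) = H y
          * (\<integral>\<^sup>+x. ennreal (HLS_weight B A (enn2real (H y)) (dist y x)) \<partial>lborel)"
        unfolding Q_def by (intro nn_integral_cmult) measurable
      also have "\<dots> \<le> H y * ennreal C2"
      proof (cases "H y = 0")
        case False
        then show ?thesis using y
            by (intro mult_left_mono C2)
            (auto simp: enn2real_positive_iff less_top zero_less_iff_neq_zero)
      qed simp
      finally show "(\<integral>\<^sup>+x. Q x y \<partial>lborel) \<le> ennreal C2 * H y" by (simp add: mult.commute)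
    qed
    also have "\<dots> \<le> ennreal C2 * 1" using H1
        by (simp add: nn_integral_cmult mult_left_mono del: mult.right_neutral)
    also have "1 * 1 + ennreal C1 * 1 + ennreal C2 * 1 = ennreal (1 + C1 + C2)"
      using C1 C2 by simp
    finally show "(\<integral>\<^sup>+x. \<integral>\<^sup>+y. epow (F x) (1 - A) * epow (H y) (1 - B) *
        ennreal (dist x y powr - (2 * (A + B))) \<partial>lborel \<partial>lborel)
       \<le> ennreal (1 + C1 + C2)" by (simp add: add_mono)
  qed
qed

text \<open>
  In terms of \<open>f\<close> and \<open>h\<close> with densities \<open>F\<close> and \<open>H\<close> equal to the powers of \<open>f\<close> and \<open>h\<close> with exponents
  \<open>1 / (1 - A)\<close> and \<open>1 / (1 - B)\<close>, this is the usual inequality in \<open>L\<^sup>P\<close> and \<open>L\<^sup>Q\<close> with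
  \<open>1/P + 1/Q + \<lambda>/2 = 2\<close>.
\<close>

theorem Hardy_Littlewood_Sobolev:
  assumes A: "0 < A" and B: "0 < B" and AB: "A + B < 1"
  obtains C where "0 \<le> C" "\<And>F H :: complex \<Rightarrow> ennreal.
     F \<in> borel_measurable borel \<Longrightarrow> H \<in> borel_measurable borel \<Longrightarrow>
     (\<integral>\<^sup>+x. \<integral>\<^sup>+y. epow (F x) (1 - A) * epow (H y) (1 - B) *
         ennreal (dist x y powr - (2 * (A + B))) \<partial>lborel \<partial>lborel)
       \<le> ennreal C * (epow (\<integral>\<^sup>+x. F x \<partial>lborel) (1 - A) * epow (\<integral>\<^sup>+x. H x \<partial>lborel) (1 - B))"
proof -
  obtain C where C: "0 \<le> C" "\<And>F H :: complex \<Rightarrow> ennreal.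
     F \<in> borel_measurable borel \<Longrightarrow> H \<in> borel_measurable borel \<Longrightarrow>
     (\<integral>\<^sup>+x. F x \<partial>lborel) \<le> 1 \<Longrightarrow> (\<integral>\<^sup>+x. H x \<partial>lborel) \<le> 1 \<Longrightarrow>
     (\<integral>\<^sup>+x. \<integral>\<^sup>+y. epow (F x) (1 - A) * epow (H y) (1 - B) *
         ennreal (dist x y powr - (2 * (A + B))) \<partial>lborel \<partial>lborel)
       \<le> ennreal C"
    using Hardy_Littlewood_Sobolev_normalised[OF assms] by blast
  show thesis
  proof
    \<comment> \<open>the summand \<open>1\<close> makes the constant nonzero, so that the bound is infinite when an integral is\<close>
    show "0 \<le> C + 1" using C by simp
    fix F H :: "complex \<Rightarrow> ennreal"
    assume [measurable]: "F \<in> borel_measurable borel" "H \<in> borel_measurable borel"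
    let ?a = "\<integral>\<^sup>+x. F x \<partial>lborel" and ?b = "\<integral>\<^sup>+x. H x \<partial>lborel"
    let ?I = "\<lambda>F H. \<integral>\<^sup>+x. \<integral>\<^sup>+y. epow (F x) (1 - A) * epow (H y) (1 - B) *
        ennreal (dist x y powr - (2 * (A + B))) \<partial>lborel \<partial>lborel"
    consider "?a = 0" | "?b = 0" | "?a \<noteq> 0" "?b \<noteq> 0" "?a = top \<or> ?b = top"
      | a b where "?a = ennreal a" "?b = ennreal b" "a > 0" "b > 0"
      by (cases ?a; cases ?b) (auto simp: ennreal_eq_0_iff, force)
    then show "?I F H \<le> ennreal (C + 1) * (epow ?a (1 - A) * epow ?b (1 - B))"
    proof cases
      case 1
      then have "AE x in lborel. F x = 0" by (simp add: nn_integral_0_iff_AE)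
      then have "?I F H = (\<integral>\<^sup>+x. 0 \<partial>(lborel :: complex measure))"
          by (intro nn_integral_cong_AE) auto
      then show ?thesis by simp
    next
      case 2
      then have "AE x in lborel. H x = 0" by (simp add: nn_integral_0_iff_AE)
      then have "(\<integral>\<^sup>+y. epow (F x) (1 - A) * epow (H y) (1 - B) *
          ennreal (dist x y powr - (2 * (A + B))) \<partial>lborel)
          = (\<integral>\<^sup>+y. 0 \<partial>(lborel :: complex measure))" for x
        by (intro nn_integral_cong_AE) (erule eventually_mono, simp)
      then show ?thesis by simp
    next
      case 3
      then have "ennreal (C + 1) * (epow ?a (1 - A) * epow ?b (1 - B)) = top"
        using C(1) by (auto simp: ennreal_mult_eq_top_iff)
      then show ?thesis by simp
    next
      case 4
      let ?F = "\<lambda>x. ennreal (1 / a) * F x" and ?H = "\<lambda>x. ennreal (1 / b) * H x"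
      have "?I F H = (\<integral>\<^sup>+x. \<integral>\<^sup>+y. ennreal (a powr (1 - A) * b powr (1 - B)) *
          (epow (?F x) (1 - A) * epow (?H y) (1 - B) *
              ennreal (dist x y powr - (2 * (A + B)))) \<partial>lborel \<partial>lborel)"
      proof (intro nn_integral_cong)
        fix x y :: complex
        \<comment> \<open>dividing both densities by their integrals makes them probability densities\<close>
        have e: "epow z r = ennreal (c powr r) * epow (ennreal (1 / c) * z) r" if "c > 0" for z c r
          using that by (simp add: epow_mult mult.assoc[symmetric] ennreal_mult'[symmetric] powr_divide)
        show "epow (F x) (1 - A) * epow (H y) (1 - B) * ennreal (dist x y powr - (2 * (A + B)))
          = ennreal (a powr (1 - A) * b powr (1 - B)) *
          (epow (?F x) (1 - A) * epow (?H y) (1 - B) * ennreal (dist x y powr - (2 * (A + B))))"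
          using 4 by (subst e[of a "F x"], simp, subst e[of b "H y"], simp)
              (simp add: ennreal_mult' mult_ac)
      qed
      also have "\<dots> = ennreal (a powr (1 - A) * b powr (1 - B)) * ?I ?F ?H"
        by (simp add: nn_integral_cmult)
      also have "\<dots> \<le> ennreal (a powr (1 - A) * b powr (1 - B)) * ennreal C"
        using 4 by (intro mult_left_mono C) (auto simp: nn_integral_cmult ennreal_mult'[symmetric])
      also have "\<dots> \<le> ennreal (C + 1) * (epow ?a (1 - A) * epow ?b (1 - B))"
        using 4 C(1)
        by (simp add: ennreal_mult'[symmetric] mult_ac ennreal_leI mult_left_mono del: ennreal_plus)
      finally show ?thesis .
    qed
  qed
qed

text \<open>
  The converse of Hoelder's inequality for a function whose density is \<open>V\<close>. The test function \<open>H\<close> is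
  \<open>V\<close> itself, truncated in height and in space so that its integral is finite and can be cancelled.
\<close>

lemma nn_integral_le_by_duality:
  fixes V :: "complex \<Rightarrow> ennreal"
  assumes [measurable]: "V \<in> borel_measurable borel" and B: "0 < B" "B < 1"
    and D: "\<And>H. H \<in> borel_measurable borel \<Longrightarrow>
       (\<integral>\<^sup>+x. epow (V x) B * epow (H x) (1 - B) \<partial>lborel) \<le> D * epow (\<integral>\<^sup>+x. H x \<partial>lborel) (1 - B)"
  shows "(\<integral>\<^sup>+x. V x \<partial>lborel) \<le> epow D (1 / B)"
proof -
  define H where "H N x = min (V x) (of_nat N) * indicator (ball 0 (real N)) x" for N x
  have [measurable]: "H N \<in> borel_measurable borel" for N
    unfolding H_def[abs_def]
    by (intro borel_measurable_times_ennreal borel_measurable_indicator) auto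
  have bound: "(\<integral>\<^sup>+x. H N x \<partial>lborel) \<le> epow D (1 / B)" for N
  proof -
    let ?E = "\<integral>\<^sup>+x. H N x \<partial>lborel"
    have "?E \<le> (\<integral>\<^sup>+x. of_nat N * indicator (ball 0 (real N)) x \<partial>(lborel :: complex measure))"
      by (intro nn_integral_mono) (auto simp: H_def intro: mult_right_mono)
    also have "\<dots> < top"
      by (simp add: nn_integral_cmult_indicator emeasure_ball ennreal_mult_less_top ennreal_of_nat_eq_real_of_nat)
    finally obtain e where e: "?E = ennreal e" "0 \<le> e" by (cases ?E) auto
    \<comment> \<open>since \<open>H N \<le> V\<close>, the hypothesis bounds the finite number \<open>?E\<close> by a multiple of its power \<open>1 - B\<close>\<close>
    have "?E = (\<integral>\<^sup>+x. epow (H N x) B * epow (H N x) (1 - B) \<partial>lborel)"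
      by (intro nn_integral_cong) (simp flip: epow_add)
    also have "\<dots> \<le> (\<integral>\<^sup>+x. epow (V x) B * epow (H N x) (1 - B) \<partial>lborel)"
      using B by (intro nn_integral_mono mult_right_mono epow_mono) (auto simp: H_def indicator_def)
    also have "\<dots> \<le> D * epow ?E (1 - B)" by (rule D) measurable
    finally have le: "?E \<le> D * epow ?E (1 - B)" .
    show ?thesis
    proof (cases "e = 0 \<or> D = top")
      case False
      then obtain d where d: "D = ennreal d" "0 \<le> d" by (cases D) auto
      have "e \<le> d * e powr (1 - B)" using le e d by (simp add: ennreal_mult'[symmetric])
      moreover have "e = e powr B * e powr (1 - B)" using e False by (simp flip: powr_add)
      ultimately have "e powr B * e powr (1 - B) \<le> d * e powr (1 - B)" by simp
      then have "e powr B \<le> d" using False e by simp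
      then have "(e powr B) powr (1 / B) \<le> d powr (1 / B)" using B by (intro powr_mono2) auto
      then show ?thesis using e d B by (simp add: powr_powr ennreal_leI)
    qed (use e in auto)
  qed
  have "(\<integral>\<^sup>+x. V x \<partial>lborel) \<le> (\<integral>\<^sup>+x. (SUP N. H N x) \<partial>lborel)"
  proof (rule nn_integral_mono)
    fix x
    show "V x \<le> (SUP N. H N x)"
    proof (cases "V x")
      case (real v)
      obtain N :: nat where N: "real N > max v (norm x)" using reals_Archimedean2 by blast
      then have "V x = H N x"
        using real by (auto simp: H_def ennreal_of_nat_eq_real_of_nat min_def)
      then show ?thesis by (metis SUP_upper UNIV_I)
    next
      case top
      obtain M :: nat where M: "real M > norm x" using reals_Archimedean2 by blast
      have "top \<le> (SUP N. of_nat N :: ennreal)" by (simp add: ennreal_SUP_of_nat_eq_top)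
      also have "\<dots> \<le> (SUP N. H N x)"
      proof (rule SUP_mono)
        fix n :: nat
        have "of_nat n \<le> H (max n M) x" using M top by (auto simp: H_def)
        then show "\<exists>m\<in>UNIV. of_nat n \<le> H m x" by blast
      qed
      finally show ?thesis using top by simp
    qed
  qed
  also have "\<dots> = (SUP N. \<integral>\<^sup>+x. H N x \<partial>lborel)"
  proof (rule nn_integral_monotone_convergence_SUP)
    show "incseq H"
      by (intro incseq_SucI le_funI)
          (auto simp: H_def indicator_def add_increasing intro!: min.mono)
  qed measurable
  also have "\<dots> \<le> epow D (1 / B)" by (rule SUP_least) (rule bound)
  finally show ?thesis .
qed

text \<open>
  The bilinear inequality with \<open>A = 1/2 - B\<close> and the kernel \<open>1 / \<bar>x - y\<bar>\<close>, dualised: the Riesz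
  potential of order one maps \<open>L\<^sup>r\<close> to \<open>L\<^sup>R\<close>, where \<open>1/r = 1/2 + B\<close> and \<open>1/R = B\<close>.
\<close>

theorem fractional_integration:
  assumes B: "0 < B" "B < 1/2"
  obtains C where "0 \<le> C" "\<And>f :: complex \<Rightarrow> ennreal. f \<in> borel_measurable borel \<Longrightarrow>
     (\<integral>\<^sup>+x. epow (\<integral>\<^sup>+y. epow (f y) (1/2 + B) * ennreal (dist x y powr - 1) \<partial>lborel) (1 / B) \<partial>lborel)
       \<le> epow (ennreal C * epow (\<integral>\<^sup>+x. f x \<partial>lborel) (1/2 + B)) (1 / B)"
proof -
  have AB: "B + (1/2 - B) < 1" "0 < 1/2 - B" using B by auto
  obtain C where C: "0 \<le> C" "\<And>F H :: complex \<Rightarrow> ennreal.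
     F \<in> borel_measurable borel \<Longrightarrow> H \<in> borel_measurable borel \<Longrightarrow>
     (\<integral>\<^sup>+x. \<integral>\<^sup>+y. epow (F x) (1 - B) * epow (H y) (1 - (1/2 - B)) *
         ennreal (dist x y powr - (2 * (B + (1/2 - B)))) \<partial>lborel \<partial>lborel)
       \<le> ennreal C * (epow (\<integral>\<^sup>+x. F x \<partial>lborel) (1 - B) * epow (\<integral>\<^sup>+x. H x \<partial>lborel) (1 - (1/2 - B)))"
    using Hardy_Littlewood_Sobolev[OF B(1) AB(2,1)] by blast
  show thesis
  proof
    show "0 \<le> C" by fact
    fix f :: "complex \<Rightarrow> ennreal" assume [measurable]: "f \<in> borel_measurable borel"
    show "(\<integral>\<^sup>+x. epow (\<integral>\<^sup>+y. epow (f y) (1/2 + B) *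
        ennreal (dist x y powr - 1) \<partial>lborel) (1 / B) \<partial>lborel)
       \<le> epow (ennreal C * epow (\<integral>\<^sup>+x. f x \<partial>lborel) (1/2 + B)) (1 / B)"
    proof (rule nn_integral_le_by_duality)
      fix H :: "complex \<Rightarrow> ennreal" assume [measurable]: "H \<in> borel_measurable borel"
      have "(\<integral>\<^sup>+x. epow (epow (\<integral>\<^sup>+y. epow (f y) (1/2 + B) *
          ennreal (dist x y powr - 1) \<partial>lborel) (1 / B)) B * epow (H x) (1 - B) \<partial>lborel)
        = (\<integral>\<^sup>+x. \<integral>\<^sup>+y. epow (H x) (1 - B) * epow (f y) (1 - (1/2 - B)) *
            ennreal (dist x y powr - (2 * (B + (1/2 - B)))) \<partial>lborel \<partial>lborel)"
        using B by (intro nn_integral_cong)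
            (simp add: epow_epow nn_integral_cmult[symmetric] mult_ac)
      also have "\<dots> \<le> ennreal C
          * (epow (\<integral>\<^sup>+x. H x \<partial>lborel) (1 - B) * epow (\<integral>\<^sup>+x. f x \<partial>lborel) (1 - (1/2 - B)))"
        by (rule C(2)) measurable
      finally show "(\<integral>\<^sup>+x. epow (epow (\<integral>\<^sup>+y. epow (f y) (1/2 + B) *
          ennreal (dist x y powr - 1) \<partial>lborel) (1 / B)) B * epow (H x) (1 - B) \<partial>lborel)
         \<le> ennreal C * epow (\<integral>\<^sup>+x. f x \<partial>lborel) (1/2 + B) * epow (\<integral>\<^sup>+x. H x \<partial>lborel) (1 - B)"
        by (simp add: mult_ac)
    qed (use B in auto)
  qed
qed

section \<open>Integrating out one variable\<close>

lemma nn_integral_translate: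
  fixes f :: "complex \<Rightarrow> ennreal"
  assumes [measurable]: "f \<in> borel_measurable borel"
  shows "(\<integral>\<^sup>+x. f (x + a) \<partial>lborel) = (\<integral>\<^sup>+x. f x \<partial>lborel)"
  by (subst (2) lborel_affine[of 1 a]) (simp_all add: nn_integral_density nn_integral_distr add.commute)

lemma nn_integral_reflect:
  fixes f :: "complex \<Rightarrow> ennreal"
  assumes [measurable]: "f \<in> borel_measurable borel" and \<sigma>: "\<sigma> = 1 \<or> \<sigma> = -1"
  shows "(\<integral>\<^sup>+x. f (a + \<sigma> * x) \<partial>lborel) = (\<integral>\<^sup>+x. f x \<partial>lborel)"
  using \<sigma>
proof
  assume "\<sigma> = 1"
  then show ?thesis using nn_integral_translate[of f a] by (simp add: add.commute)
next
  assume "\<sigma> = -1"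
  then show ?thesis
    by (subst (2) lborel_affine[of "-1" a]) (simp_all add: nn_integral_density nn_integral_distr)
qed

lemma nn_integral_Holder_iterated:
  fixes f g :: "complex \<Rightarrow> complex \<Rightarrow> ennreal"
  assumes [measurable]: "case_prod f \<in> borel_measurable (borel \<Otimes>\<^sub>M borel)"
      "case_prod g \<in> borel_measurable (borel \<Otimes>\<^sub>M borel)"
    and th: "0 < th" "th < 1"
  shows "(\<integral>\<^sup>+x. \<integral>\<^sup>+y. epow (f x y) th * epow (g x y) (1 - th) \<partial>lborel \<partial>lborel)
     \<le> epow (\<integral>\<^sup>+x. \<integral>\<^sup>+y. f x y \<partial>lborel \<partial>lborel) th *
         epow (\<integral>\<^sup>+x. \<integral>\<^sup>+y. g x y \<partial>lborel \<partial>lborel) (1 - th)"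
proof -
  have [measurable]: "case_prod f \<in> borel_measurable (lborel \<Otimes>\<^sub>M lborel)"
      "case_prod g \<in> borel_measurable (lborel \<Otimes>\<^sub>M lborel)"
    using assms(1,2) by (simp_all cong: measurable_cong_sets)
  have "(\<integral>\<^sup>+x. \<integral>\<^sup>+y. epow (f x y) th * epow (g x y) (1 - th) \<partial>lborel \<partial>lborel)
      = (\<integral>\<^sup>+z. epow (case_prod f z) th * epow (case_prod g z) (1 - th) \<partial>(lborel \<Otimes>\<^sub>M lborel))"
    by (subst lborel.nn_integral_fst[symmetric]) auto
  also have "\<dots> \<le> epow (\<integral>\<^sup>+z. case_prod f z \<partial>(lborel \<Otimes>\<^sub>M lborel)) th *
      epow (\<integral>\<^sup>+z. case_prod g z \<partial>(lborel \<Otimes>\<^sub>M lborel)) (1 - th)"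
    by (rule nn_integral_Holder) (use th in auto)
  finally show ?thesis
    by (simp add: lborel.nn_integral_fst[symmetric])
qed

text \<open>
  The effect on \<open>G\<close> of integrating out the last variable \<open>y\<close>: \<open>s\<close> is the alternating sum of the
  earlier variables, \<open>x\<close> the last of them, and \<open>\<sigma> = \<plusminus>1\<close> the sign with which \<open>y\<close> enters the sum.
\<close>

definition peel :: "complex \<Rightarrow> (complex \<Rightarrow> ennreal) \<Rightarrow> (complex \<Rightarrow> complex \<Rightarrow> ennreal) \<Rightarrow> complex \<Rightarrow> complex \<Rightarrow> ennreal" where
  "peel \<sigma> q G s x = (\<integral>\<^sup>+y. G (s + \<sigma> * y) y * q y * ennreal (dist x y powr - 1) \<partial>lborel)"

lemma borel_measurable_peel:
  assumes [measurable]: "q \<in> borel_measurable borel"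
      "case_prod G \<in> borel_measurable (borel \<Otimes>\<^sub>M borel)"
  shows "case_prod (peel \<sigma> q G) \<in> borel_measurable (borel \<Otimes>\<^sub>M borel)"
  unfolding peel_def[abs_def] by measurable

lemma epow_epow_cancel: "r \<noteq> 0 \<Longrightarrow> epow (epow x r) (1 / r) = x" "r \<noteq> 0 \<Longrightarrow> epow (epow x (1 / r)) r = x"
  by (simp_all add: epow_epow)

text \<open>
  Shears preserve the measure of the plane of pairs; the exponents of the two variables \<open>s\<close> and \<open>y\<close>
  must agree for this, which is why one exponent \<open>R\<close> is used for both.
\<close>

lemma nn_integral_shear:
  fixes G :: "complex \<Rightarrow> complex \<Rightarrow> ennreal"
  assumes [measurable]: "case_prod G \<in> borel_measurable (borel \<Otimes>\<^sub>M borel)"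
  shows "(\<integral>\<^sup>+s. \<integral>\<^sup>+y. G (s + \<sigma> * y) y \<partial>lborel \<partial>lborel) = (\<integral>\<^sup>+s. \<integral>\<^sup>+y. G s y \<partial>lborel \<partial>lborel)"
proof -
  have "(\<integral>\<^sup>+s. \<integral>\<^sup>+y. G (s + \<sigma> * y) y \<partial>lborel \<partial>lborel)
      = (\<integral>\<^sup>+y. \<integral>\<^sup>+s. G (s + \<sigma> * y) y \<partial>lborel \<partial>lborel)"
    by (rule lborel_pair.Fubini') measurable
  also have "\<dots> = (\<integral>\<^sup>+y. \<integral>\<^sup>+s. G s y \<partial>lborel \<partial>lborel)"
  proof (rule nn_integral_cong)
    fix y
    show "(\<integral>\<^sup>+s. G (s + \<sigma> * y) y \<partial>lborel) = (\<integral>\<^sup>+s. G s y \<partial>lborel)"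
      by (rule nn_integral_translate[of "\<lambda>s. G s y"]) measurable
  qed
  also have "\<dots> = (\<integral>\<^sup>+s. \<integral>\<^sup>+y. G s y \<partial>lborel \<partial>lborel)"
    by (rule lborel_pair.Fubini') measurable
  finally show ?thesis .
qed

text \<open>
  The constant of fractional integration is fixed once, so that the estimates for \<open>peel\<close> can state
  their constants explicitly; these are multiplied along the chain.
\<close>

locale fractional_integration_bound =
  fixes B C :: real
  assumes B: "0 < B" "B < 1/2" and C: "0 \<le> C"
    and frac: "\<And>f :: complex \<Rightarrow> ennreal. f \<in> borel_measurable borel \<Longrightarrow>
     (\<integral>\<^sup>+x. epow (\<integral>\<^sup>+y. epow (f y) (1/2 + B) * ennreal (dist x y powr - 1) \<partial>lborel) (1 / B) \<partial>lborel)
       \<le> epow (ennreal C * epow (\<integral>\<^sup>+x. f x \<partial>lborel) (1/2 + B)) (1 / B)"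
begin

text \<open>
  The Hoelder weight for splitting \<open>1/r = B + 1/2\<close> into the share \<open>B\<close> of \<open>G\<close> and the share \<open>1/2\<close>
  of \<open>q\<close>.
\<close>

definition \<theta> :: real where "\<theta> = B / (1/2 + B)"

lemma \<theta>: "0 < \<theta>" "\<theta> < 1" "1 - \<theta> = (1/2) / (1/2 + B)"
  using B by (auto simp: \<theta>_def field_simps)

text \<open>
  For fixed \<open>s\<close> the operator is fractional integration in the second variable. The numbers \<open>a\<close> and \<open>b\<close>
  are left open because the density of \<open>y \<mapsto> G (s + \<sigma> y) y q(y)\<close> is estimated in two different ways.
\<close>

lemma peel_slice:
  assumes [measurable]: "q \<in> borel_measurable borel"
      "case_prod G \<in> borel_measurable (borel \<Otimes>\<^sub>M borel)"
    and le: "(\<integral>\<^sup>+y. epow (G (s + \<sigma> * y) y * q y) (1 / (1/2 + B)) \<partial>lborel) \<le> epow a \<theta> *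
        epow b (1 - \<theta>)"
  shows "(\<integral>\<^sup>+x. epow (peel \<sigma> q G s x) (1 / B) \<partial>lborel)
     \<le> epow (ennreal C) (1 / B) * (a * epow b (1 / (2 * B)))"
proof -
  let ?f = "\<lambda>y. epow (G (s + \<sigma> * y) y * q y) (1 / (1/2 + B))"
  have [simp]: "epow (?f y) (1/2 + B) = G (s + \<sigma> * y) y * q y" for y
    using B by (intro epow_epow_cancel) auto
  have "(\<integral>\<^sup>+x. epow (peel \<sigma> q G s x) (1 / B) \<partial>lborel)
      = (\<integral>\<^sup>+x. epow (\<integral>\<^sup>+y. epow (?f y) (1/2 + B) *
          ennreal (dist x y powr - 1) \<partial>lborel) (1 / B) \<partial>lborel)"
    by (simp only: peel_def \<open>\<And>y. epow (?f y) (1/2 + B) = G (s + \<sigma> * y) y * q y\<close>)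
  also have "\<dots> \<le> epow (ennreal C * epow (\<integral>\<^sup>+x. ?f x \<partial>lborel) (1/2 + B)) (1 / B)"
    by (rule frac) measurable
  also have "\<dots> \<le> epow (ennreal C * epow (epow a \<theta> * epow b (1 - \<theta>)) (1/2 + B)) (1 / B)"
    using B le by (intro epow_mono mult_left_mono) auto
  also have "\<dots> = epow (ennreal C) (1 / B)
      * (epow a (\<theta> * ((1/2 + B) * (1 / B))) * epow b ((1 - \<theta>) * ((1/2 + B) * (1 / B))))"
    by (simp only: epow_mult epow_epow mult.assoc)
  also have "\<theta> * ((1/2 + B) * (1 / B)) = 1"
    using B by (simp add: \<theta>_def)
  also have "(1 - \<theta>) * ((1/2 + B) * (1 / B)) = 1 / (2 * B)"
  proof -
    have "(1/2) / D * (D * (1 / B)) = 1 / (2 * B)" if "D \<noteq> 0" for D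
      using that by simp
    from this[of "1/2 + B"] B show ?thesis unfolding \<theta>(3) by linarith
  qed
  finally show ?thesis by simp
qed

lemma peel_bound:
  assumes [measurable]: "q \<in> borel_measurable borel"
      "case_prod G \<in> borel_measurable (borel \<Otimes>\<^sub>M borel)"
  shows "(\<integral>\<^sup>+s. \<integral>\<^sup>+x. epow (peel \<sigma> q G s x) (1 / B) \<partial>lborel \<partial>lborel)
     \<le> epow (ennreal C) (1 / B) * ((\<integral>\<^sup>+s. \<integral>\<^sup>+x. epow (G s x) (1 / B) \<partial>lborel \<partial>lborel)
          * epow (\<integral>\<^sup>+x. epow (q x) 2 \<partial>lborel) (1 / (2 * B)))"
proof -
  let ?b = "\<integral>\<^sup>+x. epow (q x) 2 \<partial>lborel"
  have "(\<integral>\<^sup>+s. \<integral>\<^sup>+x. epow (peel \<sigma> q G s x) (1 / B) \<partial>lborel \<partial>lborel)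
     \<le> (\<integral>\<^sup>+s. epow (ennreal C) (1 / B)
         * ((\<integral>\<^sup>+y. epow (G (s + \<sigma> * y) y) (1 / B) \<partial>lborel) * epow ?b (1 / (2 * B))) \<partial>lborel)"
  proof (intro nn_integral_mono peel_slice)
    fix s
    have "2 * ((1/2) / D) = 1 / D" for D :: real by simp
    then have e: "1 / B * \<theta> = 1 / (1/2 + B)" "2 * (1 - \<theta>) = 1 / (1/2 + B)"
      unfolding \<theta>(3) using B by (simp add: \<theta>_def) (rule \<open>\<And>D::real. 2 * ((1/2) / D) = 1 / D\<close>)
    have "(\<integral>\<^sup>+y. epow (G (s + \<sigma> * y) y * q y) (1 / (1/2 + B)) \<partial>lborel)
      = (\<integral>\<^sup>+y. epow (epow (G (s + \<sigma> * y) y) (1 / B)) \<theta> * epow (epow (q y) 2) (1 - \<theta>) \<partial>lborel)"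
      by (simp only: epow_mult epow_epow e)
    also have "\<dots> \<le> epow (\<integral>\<^sup>+y. epow (G (s + \<sigma> * y) y) (1 / B) \<partial>lborel) \<theta> * epow ?b (1 - \<theta>)"
      by (rule nn_integral_Holder) (simp_all add: \<theta>(1,2))
    finally show "(\<integral>\<^sup>+y. epow (G (s + \<sigma> * y) y * q y) (1 / (1/2 + B)) \<partial>lborel)
        \<le> epow (\<integral>\<^sup>+y. epow (G (s + \<sigma> * y) y) (1 / B) \<partial>lborel) \<theta> * epow ?b (1 - \<theta>)" .
  qed measurable
  also have "\<dots> = epow (ennreal C) (1 / B)
      * ((\<integral>\<^sup>+s. \<integral>\<^sup>+y. epow (G (s + \<sigma> * y) y) (1 / B) \<partial>lborel \<partial>lborel) * epow ?b (1 / (2 * B)))"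
    by (simp add: nn_integral_cmult nn_integral_multc)
  also have "(\<integral>\<^sup>+s. \<integral>\<^sup>+y. epow (G (s + \<sigma> * y) y) (1 / B) \<partial>lborel \<partial>lborel)
      = (\<integral>\<^sup>+s. \<integral>\<^sup>+y. epow (G s y) (1 / B) \<partial>lborel \<partial>lborel)"
    by (rule nn_integral_shear) measurable
  finally show ?thesis .
qed

text \<open>
  For \<open>G s x = t s\<close> plain Hoelder would bound every slice by the same number, and the integral over
  \<open>s\<close> would diverge. Let \<open>T\<close> and \<open>Q\<close> be the densities of \<open>t\<close> and \<open>q\<close>. The product \<open>t q\<close> is the
  product of two factors, the power of \<open>T Q\<close> with exponent \<open>B\<close>, and the square root of the weighted
  geometric mean of \<open>T\<close> and \<open>Q\<close> with weights \<open>2 B\<close> and \<open>1 - 2 B\<close>. The geometric mean has an integral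
  over \<open>y\<close> that is bounded uniformly in \<open>s\<close>, and \<open>T Q\<close> is integrable in \<open>s\<close> and \<open>y\<close> jointly.
\<close>

lemma peel_bound_initial:
  assumes [measurable]: "t \<in> borel_measurable borel" "q \<in> borel_measurable borel"
      and \<sigma>: "\<sigma> = 1 \<or> \<sigma> = -1"
  shows "(\<integral>\<^sup>+s. \<integral>\<^sup>+x. epow (peel \<sigma> q (\<lambda>s x. t s) s x) (1 / B) \<partial>lborel \<partial>lborel)
     \<le> epow (ennreal C) (1 / B) * (epow (\<integral>\<^sup>+x. epow (t x) (1 / (2 * B)) \<partial>lborel) 2
          * epow (\<integral>\<^sup>+x. epow (q x) 2 \<partial>lborel) (1 / (2 * B)))"
proof -
  define T where "T x = epow (t x) (1 / (2 * B))" for x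
  define Q where "Q x = epow (q x) 2" for x
  have [measurable]: "T \<in> borel_measurable borel" "Q \<in> borel_measurable borel"
    unfolding T_def[abs_def] Q_def[abs_def] by measurable
  let ?a = "\<integral>\<^sup>+x. T x \<partial>lborel" and ?b = "\<integral>\<^sup>+x. Q x \<partial>lborel"
  let ?c = "epow ?a (2 * B) * epow ?b (1 - 2 * B)"
  have "(\<integral>\<^sup>+s. \<integral>\<^sup>+x. epow (peel \<sigma> q (\<lambda>s x. t s) s x) (1 / B) \<partial>lborel \<partial>lborel)
     \<le> (\<integral>\<^sup>+s. epow (ennreal C) (1 / B)
         * ((\<integral>\<^sup>+y. T (s + \<sigma> * y) * Q y \<partial>lborel) * epow ?c (1 / (2 * B))) \<partial>lborel)"
  proof (intro nn_integral_mono peel_slice)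
    fix s
    \<comment> \<open>the exponents of \<open>t\<close> and of \<open>q\<close> in the splitting of \<open>t q\<close>\<close>
    have e1: "1 / (1/2 + B) = 1 / (2 * B) * \<theta> + 1 / (2 * B) * (2 * B * (1 - \<theta>))"
    proof -
      have "1 / D = 1 / (2 * B) * (B / D) + 1 / (2 * B) * (2 * B * ((1/2) / D))" for D
        using B by (simp add: field_simps)
      then show ?thesis unfolding \<theta>(3) unfolding \<theta>_def .
    qed
    have e2: "1 / (1/2 + B) = 2 * \<theta> + 2 * ((1 - 2 * B) * (1 - \<theta>))"
    proof -
      have "1 / D = 2 * (B / D) + 2 * ((1 - 2 * B) * ((1/2) / D))" for D
        by (cases "D = 0") (simp_all add: field_simps)
      then show ?thesis unfolding \<theta>(3) unfolding \<theta>_def .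
    qed
    have "epow (t (s + \<sigma> * y) * q y) (1 / (1/2 + B))
        = epow (T (s + \<sigma> * y) * Q y) \<theta> *
            epow (epow (T (s + \<sigma> * y)) (2 * B) * epow (Q y) (1 - 2 * B)) (1 - \<theta>)" for y
    proof -
      have "epow (t (s + \<sigma> * y)) (1 / (1/2 + B)) = epow (T (s + \<sigma> * y)) \<theta> *
          epow (epow (T (s + \<sigma> * y)) (2 * B)) (1 - \<theta>)"
        by (simp only: T_def epow_epow mult.assoc e1 epow_add)
      moreover have "epow (q y) (1 / (1/2 + B)) = epow (Q y) \<theta> *
          epow (epow (Q y) (1 - 2 * B)) (1 - \<theta>)"
        by (simp only: Q_def epow_epow mult.assoc e2 epow_add)
      ultimately show ?thesis by (simp only: epow_mult mult_ac)
    qed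
    then have "(\<integral>\<^sup>+y. epow (t (s + \<sigma> * y) * q y) (1 / (1/2 + B)) \<partial>lborel)
      = (\<integral>\<^sup>+y. epow (T (s + \<sigma> * y) * Q y) \<theta> *
          epow (epow (T (s + \<sigma> * y)) (2 * B) * epow (Q y) (1 - 2 * B)) (1 - \<theta>) \<partial>lborel)"
      by simp
    also have "\<dots> \<le> epow (\<integral>\<^sup>+y. T (s + \<sigma> * y) * Q y \<partial>lborel) \<theta>
        * epow (\<integral>\<^sup>+y. epow (T (s + \<sigma> * y)) (2 * B) * epow (Q y) (1 - 2 * B) \<partial>lborel) (1 - \<theta>)"
      by (rule nn_integral_Holder) (simp_all add: \<theta>(1,2))
    also have "\<dots> \<le> epow (\<integral>\<^sup>+y. T (s + \<sigma> * y) * Q y \<partial>lborel) \<theta> * epow ?c (1 - \<theta>)"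
    proof (intro mult_left_mono epow_mono)
      have "(\<integral>\<^sup>+y. epow (T (s + \<sigma> * y)) (2 * B) * epow (Q y) (1 - 2 * B) \<partial>lborel)
        \<le> epow (\<integral>\<^sup>+y. T (s + \<sigma> * y) \<partial>lborel) (2 * B) * epow ?b (1 - 2 * B)"
        by (rule nn_integral_Holder) (use B in auto)
      then show "(\<integral>\<^sup>+y. epow (T (s + \<sigma> * y)) (2 * B) * epow (Q y) (1 - 2 * B) \<partial>lborel) \<le> ?c"
        using nn_integral_reflect[OF _ \<sigma>, of T s] by simp
    qed (use \<theta>(1,2) in simp_all)
    finally show "(\<integral>\<^sup>+y. epow (t (s + \<sigma> * y) * q y) (1 / (1/2 + B)) \<partial>lborel)
        \<le> epow (\<integral>\<^sup>+y. T (s + \<sigma> * y) * Q y \<partial>lborel) \<theta> * epow ?c (1 - \<theta>)" .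
  qed measurable
  also have "\<dots> = epow (ennreal C) (1 / B)
      * ((\<integral>\<^sup>+s. \<integral>\<^sup>+y. T (s + \<sigma> * y) * Q y \<partial>lborel \<partial>lborel) * epow ?c (1 / (2 * B)))"
    by (simp add: nn_integral_cmult nn_integral_multc)
  also have "(\<integral>\<^sup>+s. \<integral>\<^sup>+y. T (s + \<sigma> * y) * Q y \<partial>lborel \<partial>lborel)
      = (\<integral>\<^sup>+s. \<integral>\<^sup>+y. T s * Q y \<partial>lborel \<partial>lborel)"
    by (rule nn_integral_shear[of "\<lambda>s y. T s * Q y"]) measurable
  also have "\<dots> = ?a * ?b"
    by (simp add: nn_integral_cmult nn_integral_multc)
  also have "?a * ?b * epow ?c (1 / (2 * B)) = epow ?a 2 * epow ?b (1 / (2 * B))"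
  proof -
    have "epow ?c (1 / (2 * B)) = ?a * epow ?b (1 / (2 * B) - 1)"
      using B by (simp add: epow_mult epow_epow diff_divide_distrib)
    moreover have "epow ?a 2 = ?a * ?a" using epow_add[of ?a 1 1] by simp
    moreover have "epow ?b (1 / (2 * B)) = ?b * epow ?b (1 / (2 * B) - 1)"
      using epow_add[of ?b 1 "1 / (2 * B) - 1"] by simp
    ultimately show ?thesis by (simp only: mult_ac)
  qed
  finally show ?thesis by (simp only: T_def Q_def)
qed

end

text \<open>
  Hoelder on pairs separates \<open>G\<close>, with exponent \<open>1 / B\<close>, from the weight \<open>q0(x) q1(y) / \<bar>x - y\<bar>\<close>, with
  exponent \<open>1 / (1 - B)\<close>. This power of the weight is a Hardy-Littlewood-Sobolev integrand, whose
  parameters \<open>a\<close> and \<open>b\<close> are dictated by \<open>q0 \<in> L\<^sup>p\<^sup>'\<close> and \<open>q1 \<in> L\<^sup>2\<close>.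
\<close>

lemma peel_bound_final:
  assumes B: "0 < B" "B < 1/2"
  obtains D where "0 \<le> D" "\<And>q0 q1 G. q0 \<in> borel_measurable borel \<Longrightarrow> q1 \<in> borel_measurable borel \<Longrightarrow>
    case_prod G \<in> borel_measurable (borel \<Otimes>\<^sub>M borel) \<Longrightarrow>
    (\<integral>\<^sup>+x. peel (-1) q1 G x x * q0 x \<partial>lborel)
      \<le> ennreal D * (epow (\<integral>\<^sup>+s. \<integral>\<^sup>+x. epow (G s x) (1 / B) \<partial>lborel \<partial>lborel) B
          * epow (\<integral>\<^sup>+x. epow (q0 x) (1 / (1 - 2 * B)) \<partial>lborel) (1 - 2 * B)
          * epow (\<integral>\<^sup>+x. epow (q1 x) 2 \<partial>lborel) (1 / 2))"
proof -
  define a where "a = B / (1 - B)"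
  define b where "b = (1 - 2 * B) / (2 * (1 - B))"
  have ab: "0 < a" "0 < b" "a + b < 1"
    using B by (auto simp: a_def b_def field_simps)
  have e: "1 / (1 - 2 * B) * (1 - a) = 1 / (1 - B)" "2 * (1 - b) = 1 / (1 - B)"
      "- 1 * (1 / (1 - B)) = - (2 * (a + b))"
      "(1 - a) * (1 - B) = 1 - 2 * B" "(1 - b) * (1 - B) = 1 / 2"
    using B by (auto simp: a_def b_def field_simps)
  obtain C where C: "0 \<le> C" "\<And>F H :: complex \<Rightarrow> ennreal.
     F \<in> borel_measurable borel \<Longrightarrow> H \<in> borel_measurable borel \<Longrightarrow>
     (\<integral>\<^sup>+x. \<integral>\<^sup>+y. epow (F x) (1 - a) * epow (H y) (1 - b) *
         ennreal (dist x y powr - (2 * (a + b))) \<partial>lborel \<partial>lborel)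
       \<le> ennreal C * (epow (\<integral>\<^sup>+x. F x \<partial>lborel) (1 - a) * epow (\<integral>\<^sup>+x. H x \<partial>lborel) (1 - b))"
    using Hardy_Littlewood_Sobolev[OF ab] by blast
  show thesis
  proof
    show "0 \<le> C powr (1 - B)" by simp
    fix q0 q1 :: "complex \<Rightarrow> ennreal" and G :: "complex \<Rightarrow> complex \<Rightarrow> ennreal"
    assume [measurable]: "q0 \<in> borel_measurable borel" "q1 \<in> borel_measurable borel"
      "case_prod G \<in> borel_measurable (borel \<Otimes>\<^sub>M borel)"
    let ?g = "\<lambda>x y. epow (q0 x * q1 y * ennreal (dist x y powr - 1)) (1 / (1 - B))"
    let ?A = "\<integral>\<^sup>+x. epow (q0 x) (1 / (1 - 2 * B)) \<partial>lborel" and ?B = "\<integral>\<^sup>+x. epow (q1 x) 2 \<partial>lborel"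
    have "(\<integral>\<^sup>+x. peel (-1) q1 G x x * q0 x \<partial>lborel)
        = (\<integral>\<^sup>+x. \<integral>\<^sup>+y. epow (epow (G (x + (-1) * y) y) (1 / B)) B *
            epow (?g x y) (1 - B) \<partial>lborel \<partial>lborel)"
    proof (intro nn_integral_cong)
      fix x :: complex
      have "peel (-1) q1 G x x * q0 x
          = (\<integral>\<^sup>+y. G (x + (-1) * y) y * q1 y * ennreal (dist x y powr - 1) * q0 x \<partial>lborel)"
        unfolding peel_def by (intro nn_integral_multc[symmetric]) measurable
      also have "\<dots> = (\<integral>\<^sup>+y. epow (epow (G (x + (-1) * y) y) (1 / B)) B *
          epow (?g x y) (1 - B) \<partial>lborel)"
        using B by (intro nn_integral_cong) (subst (1 2) epow_epow_cancel, auto simp: mult_ac)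
      finally show "peel (-1) q1 G x x * q0 x = \<dots>" .
    qed
    also have "\<dots> \<le> epow (\<integral>\<^sup>+x. \<integral>\<^sup>+y. epow (G (x + (-1) * y) y) (1 / B) \<partial>lborel \<partial>lborel) B
        * epow (\<integral>\<^sup>+x. \<integral>\<^sup>+y. ?g x y \<partial>lborel \<partial>lborel) (1 - B)"
      using B by (intro nn_integral_Holder_iterated) simp_all
    also have "(\<integral>\<^sup>+x. \<integral>\<^sup>+y. epow (G (x + (-1) * y) y) (1 / B) \<partial>lborel \<partial>lborel)
        = (\<integral>\<^sup>+x. \<integral>\<^sup>+y. epow (G x y) (1 / B) \<partial>lborel \<partial>lborel)"
      by (rule nn_integral_shear) measurable
    also have "(\<integral>\<^sup>+x. \<integral>\<^sup>+y. ?g x y \<partial>lborel \<partial>lborel)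
      = (\<integral>\<^sup>+x. \<integral>\<^sup>+y. epow (epow (q0 x) (1 / (1 - 2 * B))) (1 - a) * epow (epow (q1 y) 2) (1 - b)
           * ennreal (dist x y powr - (2 * (a + b))) \<partial>lborel \<partial>lborel)"
      by (simp only: epow_mult epow_epow e epow_ennreal powr_ge_zero powr_powr)
    also have "\<dots> \<le> ennreal C * (epow ?A (1 - a) * epow ?B (1 - b))"
      by (rule C(2)) measurable
    finally have "(\<integral>\<^sup>+x. peel (-1) q1 G x x * q0 x \<partial>lborel)
      \<le> epow (\<integral>\<^sup>+x. \<integral>\<^sup>+y. epow (G x y) (1 / B) \<partial>lborel \<partial>lborel) B
        * epow (ennreal C * (epow ?A (1 - a) * epow ?B (1 - b))) (1 - B)"
      using B by (simp add: epow_mono mult_left_mono)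
    then show "(\<integral>\<^sup>+x. peel (-1) q1 G x x * q0 x \<partial>lborel)
      \<le> ennreal (C powr (1 - B)) * (epow (\<integral>\<^sup>+s. \<integral>\<^sup>+x. epow (G s x) (1 / B) \<partial>lborel \<partial>lborel) B
          * epow ?A (1 - 2 * B) * epow ?B (1 / 2))"
      using C(1) by (simp only: epow_mult epow_epow e epow_ennreal) (simp only: mult_ac)
  qed
qed

section \<open>Iterated integrals over tuples\<close>

interpretation lborel_tuples: product_sigma_finite "\<lambda>_::nat. lborel :: complex measure"
  by unfold_locales

definition alternating_sum :: "nat \<Rightarrow> (nat \<Rightarrow> complex) \<Rightarrow> complex" where
  "alternating_sum m x = (\<Sum>k\<in>{0..m}. (-1) ^ k * x k)"

text \<open>
  The kernels are written as powers so that they vanish where two neighbouring variables agree, in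
  accordance with the value of a quotient with denominator zero.
\<close>

definition chain_weight :: "nat \<Rightarrow> (nat \<Rightarrow> complex \<Rightarrow> ennreal) \<Rightarrow> (nat \<Rightarrow> complex) \<Rightarrow> ennreal" where
  "chain_weight m q x = (\<Prod>k\<in>{0..m}. q k (x k))
      * (\<Prod>k\<in>{1..m}. ennreal (dist (x (k - 1)) (x k) powr - 1))"

definition chain_form :: "nat \<Rightarrow> (nat \<Rightarrow> complex \<Rightarrow> ennreal) \<Rightarrow> (complex \<Rightarrow> complex \<Rightarrow> ennreal) \<Rightarrow> ennreal" where
  "chain_form m q G = (\<integral>\<^sup>+x. G (alternating_sum m x) (x m)
      * chain_weight m q x \<partial>Pi\<^sub>M {0..m} (\<lambda>_. lborel))"

lemma borel_measurable_alternating_sum [measurable]: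
  "alternating_sum m \<in> borel_measurable (Pi\<^sub>M {0..m} (\<lambda>_. lborel))"
  unfolding alternating_sum_def[abs_def] by measurable

lemma borel_measurable_chain_weight:
  assumes [measurable]: "\<And>k. q k \<in> borel_measurable borel"
  shows "chain_weight m q \<in> borel_measurable (Pi\<^sub>M {0..m} (\<lambda>_. lborel))"
proof -
  have c: "(\<lambda>x. x k) \<in> borel_measurable (Pi\<^sub>M {0..m} (\<lambda>_. lborel :: complex measure))"
      if "k \<in> {0..m}" for k
    using measurable_component_singleton[OF that, of "\<lambda>_. lborel :: complex measure"] by simp
  have "(\<lambda>x. \<Prod>k\<in>{0..m}. q k (x k)) \<in> borel_measurable (Pi\<^sub>M {0..m} (\<lambda>_. lborel :: complex measure))"
    by (intro borel_measurable_prod_ennreal measurable_compose[OF c]) auto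
  moreover have "(\<lambda>x. \<Prod>k\<in>{1..m}. ennreal (dist (x (k - 1)) (x k) powr - 1))
      \<in> borel_measurable (Pi\<^sub>M {0..m} (\<lambda>_. lborel :: complex measure))"
  proof (intro borel_measurable_prod_ennreal)
    fix k assume k: "k \<in> {1..m}"
    have [measurable]: "(\<lambda>x. x (k - 1))
        \<in> borel_measurable (Pi\<^sub>M {0..m} (\<lambda>_. lborel :: complex measure))"
      "(\<lambda>x. x k) \<in> borel_measurable (Pi\<^sub>M {0..m} (\<lambda>_. lborel :: complex measure))"
      using k by (auto intro!: c)
    show "(\<lambda>x. ennreal (dist (x (k - 1)) (x k) powr - 1))
        \<in> borel_measurable (Pi\<^sub>M {0..m} (\<lambda>_. lborel :: complex measure))"
      by measurable
  qed
  ultimately show ?thesis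
    unfolding chain_weight_def[abs_def] by (rule borel_measurable_times_ennreal)
qed

lemma borel_measurable_chain_integrand:
  assumes [measurable]: "\<And>k. q k \<in> borel_measurable borel"
      "case_prod G \<in> borel_measurable (borel \<Otimes>\<^sub>M borel)"
  shows "(\<lambda>x. G (alternating_sum m x) (x m) * chain_weight m q x)
      \<in> borel_measurable (Pi\<^sub>M {0..m} (\<lambda>_. lborel))"
proof -
  have [measurable]: "(\<lambda>x. x m) \<in> borel_measurable (Pi\<^sub>M {0..m} (\<lambda>_. lborel :: complex measure))"
    using measurable_component_singleton[of m "{0..m}" "\<lambda>_. lborel :: complex measure"] by simp
  note [measurable] = borel_measurable_chain_weight[OF assms(1)]
  show ?thesis by measurable
qed

lemma alternating_sum_Suc:
  "alternating_sum (Suc m) (x(Suc m := y)) = alternating_sum m x + (-1) ^ Suc m * y"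
proof -
  have "(\<Sum>k\<in>{0..m}. (-1) ^ k * (x(Suc m := y)) k) = (\<Sum>k\<in>{0..m}. (-1) ^ k * x k)"
    by (intro sum.cong) auto
  then show ?thesis by (simp add: alternating_sum_def)
qed

lemma chain_weight_Suc:
  "chain_weight (Suc m) q (x(Suc m := y)) = chain_weight m q x
      * (q (Suc m) y * ennreal (dist (x m) y powr - 1))"
proof -
  have "(\<Prod>k\<in>{0..m}. q k ((x(Suc m := y)) k)) = (\<Prod>k\<in>{0..m}. q k (x k))"
    by (intro prod.cong) auto
  moreover have "(\<Prod>k\<in>{1..m}. ennreal (dist ((x(Suc m := y)) (k - 1)) ((x(Suc m := y)) k) powr - 1))
      = (\<Prod>k\<in>{1..m}. ennreal (dist (x (k - 1)) (x k) powr - 1))"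
    by (intro prod.cong) auto
  ultimately show ?thesis by (simp add: chain_weight_def mult_ac)
qed

lemma chain_form_Suc:
  assumes [measurable]: "\<And>k. q k \<in> borel_measurable borel"
      "case_prod G \<in> borel_measurable (borel \<Otimes>\<^sub>M borel)"
  shows "chain_form (Suc m) q G = chain_form m q (peel ((-1) ^ Suc m) (q (Suc m)) G)"
proof -
  let ?\<sigma> = "(-1) ^ Suc m :: complex"
  have I: "{0..Suc m} = insert (Suc m) {0..m}" by auto
  have "chain_form (Suc m) q G
      = (\<integral>\<^sup>+x. \<integral>\<^sup>+y. G (alternating_sum (Suc m) (x(Suc m := y))) ((x(Suc m := y)) (Suc m))
      * chain_weight (Suc m) q (x(Suc m := y)) \<partial>lborel \<partial>Pi\<^sub>M {0..m} (\<lambda>_. lborel))"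
    unfolding chain_form_def I
    by (rule lborel_tuples.product_nn_integral_insert)
       (simp_all only: finite_atLeastAtMost atLeastAtMost_iff not_less_eq_eq[symmetric] le_refl simp_thms
          borel_measurable_chain_integrand[OF assms, of "Suc m", unfolded I])
  also have "\<dots> = (\<integral>\<^sup>+x. \<integral>\<^sup>+y. G (alternating_sum m x + ?\<sigma> * y) y * q (Suc m) y *
      ennreal (dist (x m) y powr - 1) * chain_weight m q x
      \<partial>lborel \<partial>Pi\<^sub>M {0..m} (\<lambda>_. lborel))"
    by (simp only: alternating_sum_Suc chain_weight_Suc fun_upd_same mult_ac)
  also have "\<dots> = (\<integral>\<^sup>+x. peel ?\<sigma> (q (Suc m)) G (alternating_sum m x) (x m)
      * chain_weight m q x \<partial>Pi\<^sub>M {0..m} (\<lambda>_. lborel))"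
    unfolding peel_def by (intro nn_integral_cong nn_integral_multc) measurable
  finally show ?thesis by (simp only: chain_form_def)
qed

lemma chain_form_0:
  assumes [measurable]: "q 0 \<in> borel_measurable borel"
      "case_prod G \<in> borel_measurable (borel \<Otimes>\<^sub>M borel)"
  shows "chain_form 0 q G = (\<integral>\<^sup>+x. G x x * q 0 x \<partial>lborel)"
  unfolding chain_form_def chain_weight_def alternating_sum_def
  using lborel_tuples.product_nn_integral_singleton[of "\<lambda>x. G x x * q 0 x" 0] by simp

locale chain_bound = fractional_integration_bound +
  fixes D :: real
  assumes D: "0 \<le> D"
    and last: "\<And>q0 q1 G. q0 \<in> borel_measurable borel \<Longrightarrow> q1 \<in> borel_measurable borel \<Longrightarrow>
    case_prod G \<in> borel_measurable (borel \<Otimes>\<^sub>M borel) \<Longrightarrow>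
    (\<integral>\<^sup>+x. peel (-1) q1 G x x * q0 x \<partial>lborel)
      \<le> ennreal D * (epow (\<integral>\<^sup>+s. \<integral>\<^sup>+x. epow (G s x) (1 / B) \<partial>lborel \<partial>lborel) B
          * epow (\<integral>\<^sup>+x. epow (q0 x) (1 / (1 - 2 * B)) \<partial>lborel) (1 - 2 * B)
          * epow (\<integral>\<^sup>+x. epow (q1 x) 2 \<partial>lborel) (1 / 2))"
begin

abbreviation "norm_dual q \<equiv> epow (\<integral>\<^sup>+x.
    epow (q x) (1 / (1 - 2 * B)) \<partial>(lborel :: complex measure)) (1 - 2 * B)"
abbreviation "norm_L2 q \<equiv> epow (\<integral>\<^sup>+x. epow (q x) 2 \<partial>(lborel :: complex measure)) (1 / 2)"
abbreviation "norm_pair G \<equiv> epow (\<integral>\<^sup>+s. \<integral>\<^sup>+x.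
    epow (G s x) (1 / B) \<partial>(lborel :: complex measure) \<partial>(lborel :: complex measure)) B"

lemma norm_pair_peel:
  assumes [measurable]: "q \<in> borel_measurable borel"
      "case_prod G \<in> borel_measurable (borel \<Otimes>\<^sub>M borel)"
  shows "norm_pair (peel \<sigma> q G) \<le> ennreal C * (norm_pair G * norm_L2 q)"
proof -
  have "norm_pair (peel \<sigma> q G) \<le>
      epow (epow (ennreal C) (1 / B) * ((\<integral>\<^sup>+s. \<integral>\<^sup>+x. epow (G s x) (1 / B) \<partial>lborel \<partial>lborel)
          * epow (\<integral>\<^sup>+x. epow (q x) 2 \<partial>lborel) (1 / (2 * B)))) B"
    using B by (intro epow_mono peel_bound) (auto intro: assms)
  also have "\<dots> = ennreal C * (norm_pair G * norm_L2 q)"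
    using B by (simp add: epow_mult epow_epow del: epow_ennreal)
  finally show ?thesis .
qed

text \<open>
  The induction starts with two variables, not one: with one variable the form is the integral of
  \<open>G\<close> over the diagonal, which no norm of \<open>L\<^sup>R(C \<times> C)\<close> controls.
\<close>

lemma chain_form_bound:
  assumes [measurable]: "\<And>k. q k \<in> borel_measurable borel"
      "case_prod G \<in> borel_measurable (borel \<Otimes>\<^sub>M borel)"
  shows "chain_form (Suc m) q G \<le> ennreal D * ennreal C ^ m
      * (norm_pair G * norm_dual (q 0) * (\<Prod>k\<in>{1..Suc m}. norm_L2 (q k)))"
  using assms(2)
proof (induction m arbitrary: G)
  case (0 G)
  note [measurable] = 0
  have "chain_form (Suc 0) q G = (\<integral>\<^sup>+x. peel (-1) (q 1) G x x * q 0 x \<partial>lborel)"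
    by (subst chain_form_Suc) (simp_all add: chain_form_0 borel_measurable_peel)
  then show ?case using last[of "q 0" "q 1" G] by simp
next
  case (Suc m G)
  note [measurable] = Suc.prems
  let ?P = "peel ((-1) ^ Suc (Suc m)) (q (Suc (Suc m))) G"
  have "chain_form (Suc (Suc m)) q G = chain_form (Suc m) q ?P"
    by (rule chain_form_Suc) measurable
  also have "\<dots> \<le> ennreal D * ennreal C ^ m
      * (norm_pair ?P * norm_dual (q 0) * (\<Prod>k\<in>{1..Suc m}. norm_L2 (q k)))"
    by (rule Suc.IH) (rule borel_measurable_peel; measurable)
  also have "\<dots> \<le> ennreal D * ennreal C ^ m
      * (ennreal C * (norm_pair G * norm_L2 (q (Suc (Suc m)))) * norm_dual (q 0)
      * (\<Prod>k\<in>{1..Suc m}. norm_L2 (q k)))"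
    by (intro mult_left_mono mult_right_mono norm_pair_peel) (auto intro: Suc.prems)
  also have "\<dots> = ennreal D * ennreal C ^ Suc m
      * (norm_pair G * norm_dual (q 0) * (\<Prod>k\<in>{1..Suc (Suc m)}. norm_L2 (q k)))"
    by (simp add: mult_ac)
  finally show ?case .
qed

text \<open>
  The case \<open>n = 0\<close> is Hoelder's inequality, with constant exactly \<open>1\<close> as the power \<open>c\<^sup>0\<close> requires. For
  \<open>n > 0\<close>, one final step contributes the factor \<open>D\<close> and \<open>2 n - 1\<close> steps contribute \<open>C\<close> each.
\<close>

lemma chain_form_bound_even:
  assumes [measurable]: "\<And>k. q k \<in> borel_measurable borel" "t \<in> borel_measurable borel"
  shows "chain_form (2 * n) q (\<lambda>s x. t s) \<le> ennreal (((1 + D) * (1 + C)\<^sup>2) ^ n)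
    * (epow (\<integral>\<^sup>+x. epow (t x) (1 / (2 * B)) \<partial>lborel) (2 * B) * norm_dual (q 0)
        * (\<Prod>k\<in>{1..2*n}. norm_L2 (q k)))"
    (is "_ \<le> _ * (?t * _ * _)")
proof (cases n)
  case 0
  have "chain_form 0 q (\<lambda>s x. t s)
      = (\<integral>\<^sup>+x. epow (epow (t x) (1 / (2 * B))) (2 * B) *
          epow (epow (q 0 x) (1 / (1 - 2 * B))) (1 - 2 * B) \<partial>lborel)"
    using B by (simp add: chain_form_0 epow_epow)
  also have "\<dots> \<le> ?t * norm_dual (q 0)"
    by (rule nn_integral_Holder) (use B in simp_all)
  finally show ?thesis using 0 by simp
next
  case (Suc j)
  define m where "m = 2 * j"
  have n: "2 * n = Suc (Suc m)" using Suc by (simp add: m_def)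
  let ?\<sigma> = "(-1) ^ Suc (Suc m) :: complex"
  let ?P = "peel ?\<sigma> (q (Suc (Suc m))) (\<lambda>s x. t s)"
  have "norm_pair ?P \<le> epow (epow (ennreal C) (1 / B)
      * (epow (\<integral>\<^sup>+x. epow (t x) (1 / (2 * B)) \<partial>lborel) 2
          * epow (\<integral>\<^sup>+x. epow (q (Suc (Suc m)) x) 2 \<partial>lborel) (1 / (2 * B)))) B"
    using B by (intro epow_mono peel_bound_initial) (auto simp: m_def)
  also have "\<dots> = ennreal C * (?t * norm_L2 (q (Suc (Suc m))))"
    using B by (simp add: epow_mult epow_epow del: epow_ennreal)
  finally have P: "norm_pair ?P \<le> ennreal C * (?t * norm_L2 (q (Suc (Suc m))))" .
  have "chain_form (2 * n) q (\<lambda>s x. t s) = chain_form (Suc m) q ?P"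
    unfolding n by (rule chain_form_Suc) measurable
  also have "\<dots> \<le> ennreal D * ennreal C ^ m
      * (norm_pair ?P * norm_dual (q 0) * (\<Prod>k\<in>{1..Suc m}. norm_L2 (q k)))"
    by (rule chain_form_bound) (auto intro!: borel_measurable_peel)
  also have "\<dots> \<le> ennreal D * ennreal C ^ m
      * (ennreal C * (?t * norm_L2 (q (Suc (Suc m)))) * norm_dual (q 0)
      * (\<Prod>k\<in>{1..Suc m}. norm_L2 (q k)))"
    by (intro mult_left_mono mult_right_mono P) auto
  also have "\<dots> = ennreal (D * C ^ Suc m) * (?t * norm_dual (q 0) * (\<Prod>k\<in>{1..2*n}. norm_L2 (q k)))"
    unfolding n using C D by (simp add: mult_ac ennreal_mult' ennreal_power)
  also have "D * C ^ Suc m \<le> ((1 + D) * (1 + C)\<^sup>2) ^ n"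
  proof -
    have "(1 + D) ^ 1 \<le> (1 + D) ^ n"
      using D Suc by (intro power_increasing) auto
    then have "D \<le> (1 + D) ^ n" by simp
    moreover have "C ^ Suc m \<le> (1 + C) ^ Suc (Suc m)"
    proof -
      have "C ^ Suc m \<le> (1 + C) ^ Suc m" using C by (intro power_mono) auto
      also have "\<dots> \<le> (1 + C) ^ Suc (Suc m)" using C by (intro power_increasing) auto
      finally show ?thesis .
    qed
    ultimately have "D * C ^ Suc m \<le> (1 + D) ^ n * (1 + C) ^ (2 * n)"
      unfolding n using C D by (intro mult_mono) auto
    then show ?thesis by (simp add: power_mult_distrib power_mult)
  qed
  finally show ?thesis
    by (simp add: ennreal_leI mult_right_mono)
qed

end

section \<open>Null sets and Lebesgue measurability on tuples\<close>

text \<open>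
  A function \<open>t\<close> that is only Lebesgue measurable may be composed with the alternating sum because the
  latter pulls null sets back to null sets: with all but one variable fixed, it is a translation in the
  remaining variable. The coordinate functions are the case \<open>r = 0\<close>.
\<close>

lemma
  fixes L :: "(nat \<Rightarrow> complex) \<Rightarrow> complex"
  assumes I: "finite I" "i \<in> I" and L: "L \<in> borel_measurable (Pi\<^sub>M I (\<lambda>_. lborel))"
    and affine: "\<And>x y. L (x(i := y)) = y + r x"
  shows AE_affine_coordinate: "AE z in lborel. P z \<Longrightarrow> AE x in Pi\<^sub>M I (\<lambda>_. lborel). P (L x)"
    and measurable_affine_coordinate: "L \<in> completion (Pi\<^sub>M I (\<lambda>_. lborel)) \<rightarrow>\<^sub>M lebesgue"
proof -
  let ?M = "Pi\<^sub>M I (\<lambda>_. lborel :: complex measure)"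
  have LM: "L \<in> ?M \<rightarrow>\<^sub>M lborel" using L by simp
  have null: "N \<in> null_sets (distr ?M lborel L)" if N: "N \<in> null_sets lborel" for N :: "complex set"
  proof -
    have [measurable]: "N \<in> sets borel" using N by auto
    have J: "I = insert i (I - {i})" using I by auto
    have ind: "(\<lambda>x. indicator N (L x) :: ennreal) \<in> borel_measurable ?M"
      by (rule measurable_compose[OF L]) measurable
    have "emeasure (distr ?M lborel L) N = (\<integral>\<^sup>+z. indicator N z \<partial>distr ?M lborel L)"
      by simp
    also have "\<dots> = (\<integral>\<^sup>+x. indicator N (L x) \<partial>?M)"
      by (rule nn_integral_distr[OF LM]) simp
    also have "\<dots> = (\<integral>\<^sup>+x. \<integral>\<^sup>+y. indicator N (L (x(i := y))) \<partial>lborel \<partial>Pi\<^sub>M (I - {i}) (\<lambda>_. lborel))"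
      using lborel_tuples.product_nn_integral_insert[of "I - {i}" i "\<lambda>x. indicator N (L x)"] I ind
      by (simp add: insert_absorb)
    also have "\<dots> = (\<integral>\<^sup>+x. \<integral>\<^sup>+y. indicator N y \<partial>lborel \<partial>Pi\<^sub>M (I - {i}) (\<lambda>_. lborel :: complex measure))"
      unfolding affine by (intro nn_integral_cong nn_integral_translate) measurable
    also have "\<dots> = 0" using N by (simp add: null_setsD1)
    finally show ?thesis using N by (auto simp: null_sets_def)
  qed
  show "AE x in ?M. P (L x)" if "AE z in lborel. P z"
  proof -
    from AE_E[OF that] obtain N where N: "{z \<in> space lborel. \<not> P z} \<subseteq> N" "emeasure lborel N = 0"
        "N \<in> sets lborel"
      by blast
    then have "L -` N \<inter> space ?M \<in> null_sets ?M"
      using null[of N] null_sets_distr_iff[OF LM] by (auto simp: null_sets_def)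
    then show ?thesis by (rule AE_I') (use N in auto)
  qed
  show "L \<in> completion ?M \<rightarrow>\<^sub>M lebesgue"
    using null by (intro completion.measurable_completion2 measurable_completion LM)
        (auto simp: distr_completion[OF LM])
qed

text \<open>
  For the estimates a function is replaced by a Borel version \<open>F\<close> of its absolute value, which has the
  same norm.
\<close>

lemma Lp_norm_borel:
  assumes f: "f \<in> Lp_space r" and r: "0 < r" and F: "AE x in lborel. ennreal (norm (f x)) = F x"
  shows "epow (\<integral>\<^sup>+x. epow (F x) r \<partial>lborel) (1 / r) = ennreal (Lp_norm r f)"
proof -
  have "(\<integral>\<^sup>+x. epow (F x) r \<partial>lborel) = (\<integral>\<^sup>+x. ennreal (norm (f x) powr r) \<partial>lborel)"
    by (rule nn_integral_cong_AE, rule eventually_mono[OF F]) (metis epow_ennreal norm_ge_zero)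
  also have "\<dots> = (\<integral>\<^sup>+x. ennreal (norm (f x) powr r) \<partial>lebesgue)"
    by (rule nn_integral_completion[symmetric])
  also have "\<dots> = ennreal (integral\<^sup>L lebesgue (\<lambda>x. norm (f x) powr r))"
    using f by (intro nn_integral_eq_integral) (auto simp: Lp_space_def)
  finally show ?thesis by (simp add: Lp_norm_def)
qed

lemma exists_borel_norm:
  assumes "f \<in> Lp_space r"
  obtains F where "F \<in> borel_measurable borel" "AE x in lborel. ennreal (norm (f x)) = F x"
proof -
  have "(\<lambda>x. ennreal (norm (f x))) \<in> borel_measurable (completion lborel)"
    using assms by (auto simp: Lp_space_def)
  from completion_ex_borel_measurable[OF this] show thesis using that by auto
qed

lemma alternating_sum_affine:
  "alternating_sum m (x(0 := y)) = y + alternating_sum m (x(0 := 0))"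
  by (simp add: alternating_sum_def sum.atLeast_Suc_atMost)

lemma norm_Lambda_integrand:
  "ennreal (norm (Lambda_integrand n t q x))
     = ennreal (norm (t (alternating_sum (2 * n) x)))
         * chain_weight (2 * n) (\<lambda>k z. ennreal (norm (q k z))) x"
proof -
  have "norm (Lambda_denom n x) = (\<Prod>k\<in>{1..2*n}. dist (x (k - 1)) (x k))"
    unfolding Lambda_denom_def prod_norm[symmetric]
    by (intro prod.cong) (auto simp: dist_norm simp flip: complex_cnj_diff)
  then have "inverse (norm (Lambda_denom n x)) = (\<Prod>k\<in>{1..2*n}. dist (x (k - 1)) (x k) powr - 1)"
    by (simp add: prod_inversef[symmetric] powr_minus comp_def)
  then show ?thesis
    by (simp add: Lambda_integrand_def chain_weight_def alternating_sum_def divide_inverse norm_mult norm_inverse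
        prod_norm[symmetric] ennreal_mult' prod_nonneg prod_ennreal mult_ac)
qed

theorem corollary3p10:
  fixes p p' :: real
  assumes "1 / p + 1 / p' = 1" and "\<bar>1 / p - 1 / 2\<bar> < 1 / 10"
  shows "\<exists>c::real. \<forall>(n::nat) t q.
    t \<in> Lp_space p \<longrightarrow> q 0 \<in> Lp_space p' \<longrightarrow> (\<forall>j\<in>{1..2*n}. q j \<in> Lp_space 2) \<longrightarrow>
      integrable (lebesgue_tuples n) (Lambda_integrand n t q) \<and>
      norm (Lambda_form n t q)
        \<le> c ^ n * Lp_norm p t * Lp_norm p' (q 0) * (\<Prod>j\<in>{1..2*n}. Lp_norm 2 (q j))"
proof -
  define B where "B = 1 / (2 * p)"
  have p_range: "2/5 < 1 / p" "1 / p < 3/5" "2/5 < 1 / p'"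
    using assms(1) assms(2)[unfolded abs_less_iff] by linarith+
  then have "0 < 1 / p" "0 < 1 / p'" by linarith+
  then have p: "0 < p" "0 < p'" by (simp_all only: zero_less_divide_1_iff)
  have "2 * B = 1 / p" by (simp add: B_def)
  then have "B < 1/2" using p_range by linarith
  then have Bp: "0 < B" "B < 1/2" "1 / (2 * B) = p" "2 * B = 1 / p"
    using p by (simp_all add: B_def)
  moreover have "1 - 1 / p = 1 / p'" using assms(1) by linarith
  ultimately have Bp': "1 - 2 * B = 1 / p'" "1 / (1 - 2 * B) = p'" by simp_all
  obtain C where C: "0 \<le> C" "\<And>f :: complex \<Rightarrow> ennreal. f \<in> borel_measurable borel \<Longrightarrow>
     (\<integral>\<^sup>+x. epow (\<integral>\<^sup>+y. epow (f y) (1/2 + B) * ennreal (dist x y powr - 1) \<partial>lborel) (1 / B) \<partial>lborel)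
       \<le> epow (ennreal C * epow (\<integral>\<^sup>+x. f x \<partial>lborel) (1/2 + B)) (1 / B)"
    using fractional_integration[OF Bp(1,2)] by blast
  obtain D where D: "0 \<le> D" "\<And>q0 q1 G. q0 \<in> borel_measurable borel \<Longrightarrow> q1 \<in> borel_measurable borel \<Longrightarrow>
    case_prod G \<in> borel_measurable (borel \<Otimes>\<^sub>M borel) \<Longrightarrow>
    (\<integral>\<^sup>+x. peel (-1) q1 G x x * q0 x \<partial>lborel)
      \<le> ennreal D * (epow (\<integral>\<^sup>+s. \<integral>\<^sup>+x. epow (G s x) (1 / B) \<partial>lborel \<partial>lborel) B
          * epow (\<integral>\<^sup>+x. epow (q0 x) (1 / (1 - 2 * B)) \<partial>lborel) (1 - 2 * B)
          * epow (\<integral>\<^sup>+x. epow (q1 x) 2 \<partial>lborel) (1 / 2))"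
    using peel_bound_final[OF Bp(1,2)] by blast
  interpret chain_bound B C D
    using Bp(1,2) C D by unfold_locales
  show ?thesis
  proof (intro exI[of _ "(1 + D) * (1 + C)\<^sup>2"] allI impI)
    fix n :: nat and t :: "complex \<Rightarrow> complex" and q :: "nat \<Rightarrow> complex \<Rightarrow> complex"
    assume t: "t \<in> Lp_space p" and q0: "q 0 \<in> Lp_space p'" and q: "\<forall>j\<in>{1..2*n}. q j \<in> Lp_space 2"
    let ?M = "Pi\<^sub>M {0..2*n} (\<lambda>_. lborel :: complex measure)"
    let ?c = "((1 + D) * (1 + C)\<^sup>2) ^ n"
    let ?R = "?c * Lp_norm p t * Lp_norm p' (q 0) * (\<Prod>j\<in>{1..2*n}. Lp_norm 2 (q j))"
    obtain T where T: "T \<in> borel_measurable borel" "AE z in lborel. ennreal (norm (t z)) = T z"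
      using exists_borel_norm[OF t] by blast
    have "\<exists>Q. Q \<in> borel_measurable borel \<and> (k \<le> 2
        * n \<longrightarrow> (AE z in lborel. ennreal (norm (q k z)) = Q z))" for k
    proof (cases "k \<le> 2 * n")
      case True
      then have "k = 0 \<or> k \<in> {1..2*n}" by auto
      then obtain r where "q k \<in> Lp_space r" using q0 q by blast
      then show ?thesis using exists_borel_norm by metis
    next
      \<comment> \<open>nothing is known about \<open>q\<close> beyond the index \<open>2 n\<close>\<close>
      case False
      then show ?thesis by (intro exI[of _ "\<lambda>_. 0"]) auto
    qed
    then obtain Q where Q: "\<And>k. Q k \<in> borel_measurable borel"
        "\<And>k. k \<le> 2 * n \<Longrightarrow> AE z in lborel. ennreal (norm (q k z)) = Q k z"
      by metis
    have coord: "(\<lambda>x. x k) \<in> borel_measurable ?M" if "k \<le> 2 * n" for k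
      using measurable_component_singleton[of k "{0..2*n}" "\<lambda>_. lborel :: complex measure"] that
          by simp
    have lebesgue: "f \<in> borel_measurable lebesgue" if "f \<in> Lp_space r" for f r
      using that by (simp add: Lp_space_def)
    have meas: "Lambda_integrand n t q \<in> borel_measurable (lebesgue_tuples n)"
    proof -
      have "alternating_sum (2 * n) \<in> completion ?M \<rightarrow>\<^sub>M lebesgue"
        by (rule measurable_affine_coordinate[OF _ _ borel_measurable_alternating_sum alternating_sum_affine]) auto
      then have "(\<lambda>x. t (alternating_sum (2 * n) x)) \<in> borel_measurable (completion ?M)"
        by (rule measurable_compose[OF _ lebesgue[OF t]])
      moreover have "(\<lambda>x. q k (x k)) \<in> borel_measurable (completion ?M)" if k: "k \<in> {0..2*n}" for k
      proof -
        have "(\<lambda>x. x k) \<in> completion ?M \<rightarrow>\<^sub>M lebesgue"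
          using k coord[of k] by (intro measurable_affine_coordinate[where i = k
              and r = "\<lambda>_. 0"]) auto
        moreover have "k = 0 \<or> k \<in> {1..2*n}" using k by auto
        then have "q k \<in> borel_measurable lebesgue"
          using q q0 lebesgue by blast
        ultimately show ?thesis by (rule measurable_compose)
      qed
      moreover have "Lambda_denom n \<in> borel_measurable (completion ?M)"
      proof (rule measurable_completion)
        have "(\<lambda>x. if odd k then x (k - 1) - x k else cnj (x (k - 1)) - cnj (x k))
            \<in> borel_measurable ?M"
          if "k \<in> {1..2*n}" for k
        proof -
          have [measurable]: "(\<lambda>x. x (k - 1)) \<in> borel_measurable ?M"
              "(\<lambda>x. x k) \<in> borel_measurable ?M"
            using that by (auto intro!: coord)
          have [measurable]: "cnj \<in> borel_measurable borel"
            by (intro borel_measurable_continuous_onI continuous_on_cnj continuous_on_id)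
          show ?thesis by measurable
        qed
        then show "Lambda_denom n \<in> borel_measurable ?M"
          unfolding Lambda_denom_def[abs_def] by (intro borel_measurable_prod) auto
      qed
      ultimately show ?thesis
        unfolding Lambda_integrand_def[abs_def] lebesgue_tuples_def alternating_sum_def
        by (intro borel_measurable_divide borel_measurable_times borel_measurable_prod) auto
    qed
    have ae_t: "AE x in ?M. ennreal (norm (t (alternating_sum (2 * n) x)))
        = T (alternating_sum (2 * n) x)"
      by (rule AE_affine_coordinate[OF _ _ borel_measurable_alternating_sum alternating_sum_affine T(2)]) auto
    have "AE x in ?M. ennreal (norm (q k (x k))) = Q k (x k)" if "k \<in> {0..2*n}" for k
      by (rule AE_affine_coordinate[where i = k and L = "\<lambda>x. x k" and r = "\<lambda>_. 0"
          and P = "\<lambda>z. ennreal (norm (q k z)) = Q k z"])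
         (use that coord Q(2)[of k] in auto)
    then have ae_q: "AE x in ?M. \<forall>k\<in>{0..2*n}. ennreal (norm (q k (x k))) = Q k (x k)"
      by (intro AE_finite_allI) auto
    have "(\<integral>\<^sup>+x. ennreal (norm (Lambda_integrand n t q x)) \<partial>lebesgue_tuples n)
        = (\<integral>\<^sup>+x. ennreal (norm (Lambda_integrand n t q x)) \<partial>?M)"
      unfolding lebesgue_tuples_def by (rule nn_integral_completion)
    also have "\<dots> = chain_form (2 * n) Q (\<lambda>s x. T s)"
      unfolding chain_form_def norm_Lambda_integrand
      using ae_t ae_q
      by (intro nn_integral_cong_AE, eventually_elim) (simp add: chain_weight_def)
    also have "\<dots> \<le> ennreal ?c * (epow (\<integral>\<^sup>+x. epow (T x) p \<partial>lborel) (1 / p)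
        * epow (\<integral>\<^sup>+x. epow (Q 0 x) p' \<partial>lborel) (1 / p') * (\<Prod>k\<in>{1..2*n}. norm_L2 (Q k)))"
      using chain_form_bound_even[of Q T n, OF Q(1) T(1)]
      by (simp only: Bp(3) Bp'(2)) (simp only: Bp'(1), simp only: Bp(4))
    also have "(\<Prod>k\<in>{1..2*n}. norm_L2 (Q k)) = (\<Prod>k\<in>{1..2*n}. ennreal (Lp_norm 2 (q k)))"
      using q Q(2) by (intro prod.cong Lp_norm_borel) auto
    also have "epow (\<integral>\<^sup>+x. epow (T x) p \<partial>lborel) (1 / p) = ennreal (Lp_norm p t)"
      using t p T by (intro Lp_norm_borel)
    also have "epow (\<integral>\<^sup>+x. epow (Q 0 x) p' \<partial>lborel) (1 / p') = ennreal (Lp_norm p' (q 0))"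
      using q0 p Q(2)[of 0] by (intro Lp_norm_borel) auto
    also have "ennreal ?c * (ennreal (Lp_norm p t) * ennreal (Lp_norm p' (q 0))
        * (\<Prod>k\<in>{1..2*n}. ennreal (Lp_norm 2 (q k)))) = ennreal ?R"
      using C(1) D(1) by (simp add: prod_ennreal Lp_norm_def ennreal_mult'[symmetric] prod_nonneg mult_ac)
    finally have bound: "(\<integral>\<^sup>+x. ennreal (norm (Lambda_integrand n t q x)) \<partial>lebesgue_tuples n) \<le>
        ennreal ?R" .
    have int: "integrable (lebesgue_tuples n) (Lambda_integrand n t q)"
      using meas le_less_trans[OF bound ennreal_less_top] by (intro integrableI_bounded) auto
    have "ennreal (norm (Lambda_form n t q)) \<le> ennreal ?R"
      unfolding Lambda_form_def by (rule order_trans[OF integral_norm_bound_ennreal[OF int] bound])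
    moreover have "0 \<le> ?R"
      using C(1) D(1) by (simp add: Lp_norm_def prod_nonneg)
    ultimately show "integrable (lebesgue_tuples n) (Lambda_integrand n t q) \<and> norm (Lambda_form n t q) \<le> ?R"
      using int by simp
  qed
qed

end
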